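(* Let $u_1\ge1$, $b_1,b_2\ge2$, $s_1,s_2\ge1$ and $r_1,r_2$ be integers with $u_1<b_1$ and $\gcd(r_i,s_i)=1$, and consider $f(x)=\frac{u_1}{b_1}x+\frac{r_1}{s_1}$, $g(x)=\frac{1}{b_2}x+\frac{r_2}{s_2}$. Assume that $f$ and $g$ have different fixed points, i.e. $\frac{b_1r_1}{(b_1-u_1)s_1}\neq\frac{b_2r_2}{(b_2-1)s_2}$. Let $C$ be the attractor of $\{f,g\}$, $m\ge2$ an integer and $K=C^m$. Then for every $\omega\in[\frac1m,\frac1{m-1}]\cup\{1\}$ there exist totally irrational Liouville vectors $\boldsymbol{\xi}\in K$ with $\widehat{\omega}(\boldsymbol{\xi})=\omega$. In particular, the set of values $\widehat{\omega}(\boldsymbol{\xi})$ for totally irrational $\boldsymbol{\xi}\in K$ contains $[\frac1m,\frac1{m-1}]\cup\{1\}$.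
   Context: The attractor $C$ is the unique nonempty compact set with $C=f(C)\cup g(C)$. $\Vert\boldsymbol{\xi}\Vert$ denotes the maximum-norm distance of $\boldsymbol{\xi}\in\mathbb{R}^m$ to the nearest integer vector. The exponent $\widehat{\omega}(\boldsymbol{\xi})$ is the supremum of $t$ such that $1\le q\le Q$, $\Vert q\boldsymbol{\xi}\Vert\le Q^{-t}$ has an integer solution $q$ for all sufficiently large $Q$. A vector is totally irrational if it does not lie in any rational affine hyperplane of $\mathbb{R}^m$. A vector $\boldsymbol{\xi}\in\mathbb{R}^m\setminus\mathbb{Q}^m$ is Liouville if for arbitrarily large $t>0$ there is an integer $q\ge1$ with $\Vert q\boldsymbol{\xi}\Vert\le q^{-t}$. *)

theory Defs
  imports "HOL-Analysis.Analysis"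
begin

definition attractor :: "(real \<Rightarrow> real) \<Rightarrow> (real \<Rightarrow> real) \<Rightarrow> real set" where
  "attractor f g = (THE C. compact C \<and> C \<noteq> {} \<and> C = f ` C \<union> g ` C)"

text \<open>The following two lemmas show that the description in \<^const>\<open>attractor\<close> is proper for contractions.\<close>

lemma invariant_compact_subset:
  fixes f g :: "real \<Rightarrow> real"
  assumes c: "0 \<le> c" "c < 1"
    and f: "\<And>x y. \<bar>f x - f y\<bar> \<le> c * \<bar>x - y\<bar>"
    and g: "\<And>x y. \<bar>g x - g y\<bar> \<le> c * \<bar>x - y\<bar>"
    and C: "compact C" "C = f ` C \<union> g ` C"
    and D: "compact D" "D \<noteq> {}" "D = f ` D \<union> g ` D"
  shows "C \<subseteq> D"
proof (cases "C = {}")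
  case False
  have "continuous_on C (\<lambda>x. infdist x D)"
    by (intro continuous_intros)
  then obtain x where x: "x \<in> C" and max: "\<And>y. y \<in> C \<Longrightarrow> infdist y D \<le> infdist x D"
    using continuous_attains_sup[OF C(1) False] by blast
  have step: "infdist (h y) D \<le> c * infdist y D"
    if "y \<in> C" "h ` D \<subseteq> D" "\<And>u v. \<bar>h u - h v\<bar> \<le> c * \<bar>u - v\<bar>" for h y
  proof -
    obtain d where d: "d \<in> D" "infdist y D = dist y d"
      using infdist_attains_inf[OF compact_imp_closed[OF D(1)] D(2)] by blast
    have "infdist (h y) D \<le> dist (h y) (h d)"
      using d(1) that(2) by (intro infdist_le) auto
    also have "\<dots> \<le> c * infdist y D"
      using that(3)[of y d] d(2) by (simp add: dist_real_def)
    finally show ?thesis .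
  qed
  obtain y where y: "y \<in> C" "x = f y \<or> x = g y"
    using x C(2) by blast
  have "infdist x D \<le> c * infdist y D"
    using y step[of y f] step[of y g] f g D(3) by blast
  also have "\<dots> \<le> c * infdist x D"
    using max[OF y(1)] c by (simp add: mult_left_mono)
  finally have "(1 - c) * infdist x D \<le> 0"
    by (simp add: algebra_simps)
  then have "infdist x D \<le> 0"
    using c by (simp add: mult_le_0_iff)
  then have "infdist z D = 0" if "z \<in> C" for z
    using max[OF that] infdist_nonneg[of z D] by linarith
  then show ?thesis
    using D in_closed_iff_infdist_zero compact_imp_closed by blast
qed simp

lemma attractor_unique_existence:
  fixes f g :: "real \<Rightarrow> real"
  assumes c: "0 \<le> c" "c < 1"
    and f: "\<And>x y. \<bar>f x - f y\<bar> \<le> c * \<bar>x - y\<bar>"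
    and g: "\<And>x y. \<bar>g x - g y\<bar> \<le> c * \<bar>x - y\<bar>"
  shows "\<exists>!C. compact C \<and> C \<noteq> {} \<and> C = f ` C \<union> g ` C"
proof (rule ex_ex1I)
  define R where "R = max \<bar>f 0\<bar> \<bar>g 0\<bar> / (1 - c)"
  have R: "\<bar>f 0\<bar> \<le> (1 - c) * R" "\<bar>g 0\<bar> \<le> (1 - c) * R"
    using c by (auto simp: R_def)
  define B where "B = cball (0::real) R"
  have into_B: "h x \<in> B"
    if "\<And>u v. \<bar>h u - h v\<bar> \<le> c * \<bar>u - v\<bar>" "\<bar>h 0\<bar> \<le> (1 - c) * R" "x \<in> B" for h :: "real \<Rightarrow> real" and x
  proof -
    have "\<bar>x\<bar> \<le> R"
      using that(3) by (simp add: B_def)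
    then have "c * \<bar>x\<bar> \<le> c * R"
      using c by (simp add: mult_left_mono)
    then have "\<bar>h x\<bar> \<le> (1 - c) * R + c * R"
      using that(1)[of x 0] that(2) by auto
    then show ?thesis
      by (simp add: B_def algebra_simps)
  qed
  define T where "T A = f ` A \<union> g ` A" for A
  have T_B: "T A \<subseteq> B" if "A \<subseteq> B" for A
    using that into_B f g R unfolding T_def by blast
  have "mono (\<lambda>A. B \<inter> T A)"
    by (auto simp: mono_def T_def)
  define C where "C = gfp (\<lambda>A. B \<inter> T A)"
  have "C = B \<inter> T C"
    unfolding C_def by (rule gfp_unfold) fact
  then have C: "C \<subseteq> B" "C = T C"
    using T_B[of C] by auto
  have C_upper: "A \<subseteq> C" if "A \<subseteq> B" "A \<subseteq> T A" for A
    unfolding C_def using that by (intro gfp_upperbound) auto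
  have cont: "continuous_on A h" if "\<And>u v. \<bar>h u - h v\<bar> \<le> c * \<bar>u - v\<bar>" for A and h :: "real \<Rightarrow> real"
  proof -
    have "c-lipschitz_on A h"
      using that c by (auto intro!: lipschitz_onI simp: dist_real_def)
    then show ?thesis
      by (rule lipschitz_on_continuous_on)
  qed
  have clB: "closure C \<subseteq> B"
    using C(1) by (simp add: B_def closure_minimal)
  then have comp: "compact (closure C)"
    unfolding B_def using bounded_cball bounded_subset by (auto simp: compact_eq_bounded_closed)
  have "compact (T (closure C))"
    unfolding T_def using comp cont[OF f] cont[OF g]
    by (intro compact_Un compact_continuous_image) auto
  moreover have "T C \<subseteq> T (closure C)"
    unfolding T_def using closure_subset by blast
  ultimately have "closure C \<subseteq> T (closure C)"
    using C(2) by (simp add: closure_minimal compact_imp_closed)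
  then have "closure C = C"
    using C_upper[OF clB] closure_subset by blast
  moreover obtain p where "p \<in> B" "f p = p"
  proof -
    have "\<exists>!x. x \<in> B \<and> f x = x"
    proof (rule Banach_fix[OF _ _ c])
      show "complete B"
        by (simp add: B_def complete_eq_closed)
      show "B \<noteq> {}"
        using c by (simp add: B_def R_def field_simps not_less le_max_iff_disj)
      show "f ` B \<subseteq> B"
        using into_B[OF f R(1)] by blast
    qed (use f in \<open>auto simp: dist_real_def\<close>)
    then show thesis
      using that by blast
  qed
  then have "p \<in> C"
    using C_upper[of "{p}"] by (auto simp: T_def)
  ultimately show "\<exists>C. compact C \<and> C \<noteq> {} \<and> C = f ` C \<union> g ` C"
    using comp C(2) unfolding T_def by (metis empty_iff)
next
  show "C = D"
    if "compact C \<and> C \<noteq> {} \<and> C = f ` C \<union> g ` C" "compact D \<and> D \<noteq> {} \<and> D = f ` D \<union> g ` D"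
    for C D
    using that invariant_compact_subset[OF c f g] by (meson subset_antisym)
qed

definition dist_to_int :: "real ^ 'm \<Rightarrow> real" where
  "dist_to_int \<xi> = (INF p \<in> {p. \<forall>i. p $ i \<in> \<int>}. infnorm (\<xi> - p))"

text \<open>
  The supremum is taken in the extended reals, since the set of admissible exponents is unbounded
  for rational vectors.
\<close>

definition omega_hat :: "real ^ 'm \<Rightarrow> ereal" where
  "omega_hat \<xi> = Sup (ereal ` {t::real. \<forall>\<^sub>F Q::real in at_top.
     \<exists>q::int. 1 \<le> q \<and> of_int q \<le> Q \<and> dist_to_int (of_int q *\<^sub>R \<xi>) \<le> Q powr (- t)})"

definition totally_irrational :: "real ^ 'm \<Rightarrow> bool" where
  "totally_irrational \<xi> \<longleftrightarrow>
     \<not> (\<exists>(a :: real ^ 'm) b. a \<noteq> 0 \<and> (\<forall>i. a $ i \<in> \<rat>) \<and> b \<in> \<rat> \<and> a \<bullet> \<xi> = b)"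

text \<open>
  The witness \<open>q\<close> has to be at least \<open>2\<close>: for \<open>q = 1\<close> the inequality reads
  \<open>dist_to_int \<xi> \<le> 1\<close>, which every vector satisfies.
\<close>

definition liouville :: "real ^ 'm \<Rightarrow> bool" where
  "liouville \<xi> \<longleftrightarrow> \<not> (\<forall>i. \<xi> $ i \<in> \<rat>) \<and>
     (\<forall>T. \<exists>t::real. t > T \<and> t > 0 \<and>
        (\<exists>q::int. 2 \<le> q \<and> dist_to_int (of_int q *\<^sub>R \<xi>) \<le> of_int q powr (- t)))"

end

theory Submission
  imports Defs
begin

text \<open>
  Let \<open>p\<close> be the fixed point of \<open>g\<close> and \<open>\<gamma> = f p - p \<noteq> 0\<close>. Words of the form \<open>g ^ n0 f g ^ n1 f \<dots>\<close> show that
  \<open>C\<close> contains \<open>p + \<gamma> (\<Sum>k. (u1 / b1) ^ k / b2 ^ a k)\<close> for every nondecreasing sequence \<open>a\<close>. Coordinate \<open>i\<close> of the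
  vector is such a number with exponents \<open>a k i\<close>. Stage \<open>k + 1\<close> lives on a scale so much larger than stage \<open>k\<close>
  that everything up to stage \<open>k\<close> becomes negligible after clearing denominators; this gives the Liouville
  property and total irrationality. Within one stage the vector then behaves like
  \<open>(b2 ^ - a k 0, \<dots>, b2 ^ - a k n)\<close>, and the ratios of these exponents determine the uniform exponent.
\<close>

section \<open>Preliminaries\<close>

text \<open>Two bounds squeeze the uniform exponent. The denominator clearing everything before
  stage \<open>k\<close> serves up to about \<open>b ^ a k (n - 1)\<close>, with error about
  \<open>b ^ - a k 0\<close>; clearing also all digits of stage \<open>k\<close> but the last then
  serves up to about \<open>b ^ a k n\<close>. This gives the lower bound
  min(\<open>a k 0 / a k (n - 1)\<close>, \<open>1 - a k (n - 1) / a k n\<close>). The upper bound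
  is the largest of \<open>a k 0\<close> and the steps \<open>a k (i + 1) - a k i\<close>, divided
  by \<open>a k n\<close>. For exponents A, 2A, ..., nA, D with D = nA / (1 - \<omega>) the last
  step has ratio \<omega>; the other constraints read \<omega> <= 1 / n and A / D <= \<omega>, that
  is \<omega> >= 1 / (n + 1). With m = n + 1 this is where the interval comes from. The obstacle is
  that the slope \<open>u1 / b1\<close> of \<open>f\<close> has nothing to do with
  \<open>b2\<close>, so denominators carry powers of \<open>b1\<close>. They cost only a factor
  \<open>b2 ^ O(k)\<close>, which the superlinear growth of the stages absorbs, and the numerators
  \<open>u1 ^ k\<close> are the same in all coordinates, so one integer multiplier accounts for
  them.\<close>

lemma dist_to_int_le:
  fixes \<eta> :: "real ^ 'm"
  assumes "\<And>i. \<exists>z\<in>\<int>. \<bar>\<eta> $ i - z\<bar> \<le> d"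
  shows "dist_to_int \<eta> \<le> d"
proof -
  obtain z where z: "\<And>i. z i \<in> \<int>" "\<And>i. \<bar>\<eta> $ i - z i\<bar> \<le> d"
    using assms by metis
  have "dist_to_int \<eta> \<le> infnorm (\<eta> - (\<chi> i. z i))"
    unfolding dist_to_int_def
    by (rule cINF_lower) (auto simp: z intro!: bdd_belowI[of _ 0] infnorm_pos_le)
  also have "\<dots> \<le> d"
    unfolding infnorm_def by (rule cSup_least) (auto simp: Basis_vec_def inner_axis z)
  finally show ?thesis .
qed

lemma dist_to_int_lessD:
  fixes \<eta> :: "real ^ 'm"
  assumes "dist_to_int \<eta> < d"
  shows "\<exists>z\<in>\<int>. \<bar>\<eta> $ i - z\<bar> < d"
proof -
  have "\<exists>w\<in>(\<lambda>p. infnorm (\<eta> - p)) ` {p. \<forall>i. p $ i \<in> \<int>}. w < d"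
    using assms unfolding dist_to_int_def
    by (intro cInf_lessD) (auto intro: exI[of _ 0])
  then obtain p where p: "\<And>i. p $ i \<in> \<int>" "infnorm (\<eta> - p) < d"
    by auto
  then have "\<bar>\<eta> $ i - p $ i\<bar> < d"
    using component_le_infnorm_cart[of "\<eta> - p" i] by simp
  with p show ?thesis by blast
qed

text \<open>Cancelling \<open>b ^ x\<close> leaves a fraction with denominator
  \<open>b ^ (y - x)\<close>, whose distance to any integer is a multiple of
  \<open>1 / b ^ (y - x)\<close>; a smaller distance must be zero.\<close>

lemma pow_dvd_if_near_int:
  fixes b w :: int and z :: real
  assumes "1 \<le> b" "x \<le> y" "b ^ x dvd w" "z \<in> \<int>"
    and "\<bar>of_int w / of_int b ^ y - z\<bar> < 1 / of_int b ^ (y - x)"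
  shows "b ^ y dvd w"
proof -
  obtain w' where w: "w = b ^ x * w'" using assms by (elim dvdE)
  obtain z' where z: "z = of_int z'" using assms by (elim Ints_cases)
  have pos: "(0::real) < of_int b ^ k" for k
    using assms by simp
  have y: "b ^ y = b ^ x * b ^ (y - x)" "(of_int b :: real) ^ y = of_int b ^ x * of_int b ^ (y - x)"
    using assms by (simp_all flip: power_add)
  have "of_int w / of_int b ^ y = (of_int w' / of_int b ^ (y - x) :: real)"
    using assms(1) unfolding w y of_int_mult of_int_power by simp
  then have "\<bar>of_int w' / of_int b ^ (y - x) - of_int z'\<bar> * of_int b ^ (y - x) < (1 / of_int b ^ (y - x)) * (of_int b ^ (y - x) :: real)"
    using assms(5) z pos by (intro mult_strict_right_mono) auto
  then have "\<bar>(of_int w' / of_int b ^ (y - x) - of_int z') * of_int b ^ (y - x)\<bar> < (1::real)"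
    using pos[of "y - x"] assms(1) by (simp add: abs_mult)
  then have "\<bar>of_int (w' - z' * b ^ (y - x))\<bar> < (1::real)"
    using assms(1) by (simp add: algebra_simps)
  then have "w' = z' * b ^ (y - x)" by linarith
  then show ?thesis
    unfolding w y by simp
qed

text \<open>Centred at \<open>p\<close>, the map \<open>g\<close> is pure scaling. The induction
  peels off the outermost block of the word, \<open>f\<close> followed by \<open>a 0\<close>
  applications of \<open>g\<close>; what remains has exponents \<open>a (Suc j) - a 0\<close>, hence
  the generalisation over \<open>a\<close>. Monotonicity keeps these differences from being
  truncated.\<close>

lemma affine_words_in_attractor:
  fixes f g :: "real \<Rightarrow> real"
  assumes f: "\<And>z. f (p + z) = p + \<gamma> + \<beta> * z" and g: "\<And>z. g (p + z) = p + z / b"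
    and C: "f ` C \<subseteq> C" "g ` C \<subseteq> C" and p: "p \<in> C" and a: "mono a"
  shows "p + \<gamma> * (\<Sum>j<J. \<beta> ^ j / b ^ a j) \<in> C"
  using a
proof (induction J arbitrary: a)
  case 0
  then show ?case using p by simp
next
  case (Suc J)
  have gn: "(g ^^ n) (p + z) = p + z / b ^ n" for n z
    by (induction n) (simp_all add: g mult.commute)
  have gC: "(g ^^ n) y \<in> C" if "y \<in> C" for n y
    using that C by (induction n) auto
  have le: "a 0 \<le> a (Suc j)" for j
    using Suc.prems by (simp add: monoD)
  have "mono (\<lambda>j. a (Suc j) - a 0)"
    using Suc.prems by (intro monoI diff_le_mono) (simp add: monoD)
  from Suc.IH[OF this] have y: "p + \<gamma> * (\<Sum>j<J. \<beta> ^ j / b ^ (a (Suc j) - a 0)) \<in> C" (is "p + ?z \<in> C") .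
  have eq: "\<beta> ^ j / b ^ (a (Suc j) - a 0) / b ^ a 0 = \<beta> ^ j / b ^ a (Suc j)" for j
    using le[of j] by (simp flip: power_add)
  have "(\<gamma> + \<beta> * ?z) / b ^ a 0 = \<gamma> / b ^ a 0 + \<beta> * (\<gamma> * (\<Sum>j<J. \<beta> ^ j / b ^ (a (Suc j) - a 0) / b ^ a 0))"
    by (simp add: add_divide_distrib flip: sum_divide_distrib del: divide_divide_eq_left)
  also have "\<dots> = \<gamma> * (\<Sum>j<Suc J. \<beta> ^ j / b ^ a j)"
    unfolding eq by (subst sum.lessThan_Suc_shift) (simp add: sum_distrib_left algebra_simps)
  finally have "(g ^^ a 0) (f (p + ?z)) = p + \<gamma> * (\<Sum>j<Suc J. \<beta> ^ j / b ^ a j)"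
    unfolding f add.assoc gn by simp
  moreover have "(g ^^ a 0) (f (p + ?z)) \<in> C"
    using y C gC by blast
  ultimately show ?case by simp
qed

section \<open>Lacunary vectors\<close>

text \<open>
  In the application \<open>p\<close> is the fixed point of \<open>g\<close>, \<open>\<gamma> = f p - p\<close>, \<open>u / v\<close> and \<open>1 / b\<close> are the slopes of
  \<open>f\<close> and \<open>g\<close>, \<open>s\<close> is a common denominator of \<open>p\<close> and \<open>\<gamma>\<close>, and \<open>b ^ L\<close> absorbs all constants.
  There are \<open>n + 1\<close> coordinates, numbered from \<open>0\<close> through \<open>idx\<close>.
\<close>

locale lacunary_vector =
  fixes b u v s :: int and p \<gamma> :: real and L n :: nat
    and a :: "nat \<Rightarrow> nat \<Rightarrow> nat" and idx :: "'m::finite \<Rightarrow> nat"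
  assumes b: "2 \<le> b" and u: "1 \<le> u" "u < v" and s: "1 \<le> s"
    and int: "of_int s * p \<in> \<int>" "of_int s * \<gamma> \<in> \<int>" and \<gamma>: "\<gamma> \<noteq> 0"
    and L: "s \<le> b ^ L" "v \<le> b ^ L" "2 * \<bar>\<gamma>\<bar> \<le> of_int b ^ L"
    and n: "1 \<le> n" and idx: "bij_betw idx UNIV {..n}"
    and gap: "i < n \<Longrightarrow> a k i + k \<le> a k (Suc i)"
    and growth: "Suc k * (a k n + Suc k) \<le> a (Suc k) 0"
begin

section \<open>Digits, partial sums and tails of the coordinates\<close>

definition digit :: "nat \<Rightarrow> nat \<Rightarrow> real" where
  "digit i j = (of_int u / of_int v) ^ j / of_int b ^ a j i"

definition part :: "nat \<Rightarrow> nat \<Rightarrow> real" where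
  "part k i = p + \<gamma> * (\<Sum>j<k. digit i j)"

definition tail :: "nat \<Rightarrow> nat \<Rightarrow> real" where
  "tail k i = \<gamma> * (\<Sum>j. digit i (j + k))"

definition coord :: "nat \<Rightarrow> real" where
  "coord i = p + \<gamma> * (\<Sum>j. digit i j)"

definition point :: "real ^ 'm" where
  "point = (\<chi> i. coord (idx i))"

lemma idx_le [simp]: "idx i \<le> n"
  using idx by (auto simp: bij_betw_def)

lemma a_mono: "i \<le> j \<Longrightarrow> j \<le> n \<Longrightarrow> a k i \<le> a k j"
proof (induction j)
  case (Suc j)
  then show ?case using gap[of j k] by (cases "i = Suc j") auto
qed simp

lemma growth_less: "a k n + Suc k \<le> a (Suc k) 0"
  using growth[of k] by simp

lemma a_Suc: "i \<le> n \<Longrightarrow> Suc (a k i) \<le> a (Suc k) i"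
  using growth_less[of k] a_mono[of i n k] a_mono[of 0 i "Suc k"] by simp

lemma a_add: "i \<le> n \<Longrightarrow> j + a k i \<le> a (j + k) i"
  proof (induction j)
  case (Suc j)
  then show ?case using a_Suc[of i "j + k"] by simp
qed simp

lemma a_mono2: "i \<le> n \<Longrightarrow> k \<le> l \<Longrightarrow> a k i \<le> a l i"
  using a_add[of i "l - k" k] by simp

text \<open>The factor \<open>Suc k\<close> in \<open>growth\<close> overtakes any constant. The
  summand \<open>real k\<close> pays for the powers of \<open>v\<close>, which are exponential in
  \<open>k\<close>.\<close>

lemma growth_eventually:
  fixes c :: real
  shows "\<forall>\<^sub>F k in sequentially. c * (real (a k n) + real k + 1) \<le> a (Suc k) 0"
proof -
  obtain K :: nat where K: "c \<le> K" using real_arch_simple by blast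
  have "c * (real (a k n) + real k + 1) \<le> a (Suc k) 0" if "k \<ge> K" for k
  proof -
    have "c * (real (a k n) + real k + 1) \<le> real (Suc k) * (real (a k n) + real k + 1)"
      using K that by (intro mult_right_mono) auto
    also have "\<dots> = real (Suc k * (a k n + Suc k))" unfolding of_nat_mult of_nat_add by simp
    also have "\<dots> \<le> a (Suc k) 0" using growth[of k] by (simp only: of_nat_le_iff)
    finally show ?thesis .
  qed
  then show ?thesis unfolding eventually_sequentially by blast
qed

lemma u_over_v: "0 < (of_int u / of_int v :: real)" "(of_int u / of_int v :: real) \<le> 1"
  using u by auto

lemma b_pow_pos [simp]: "(0::real) < of_int b ^ k"
  using b by simp

lemma b_pow_nonneg [simp]: "(0::real) \<le> of_int b ^ k"
  by (rule less_imp_le) simp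

lemma b_pow_mono: "k \<le> l \<Longrightarrow> (of_int b :: real) ^ k \<le> of_int b ^ l"
  using b by (intro power_increasing) auto

lemma digit_pos: "0 < digit i j"
  unfolding digit_def using u_over_v by simp

text \<open>Exponents rise by at least one per stage, which gives a geometric majorant of ratio 1/2;
  it yields both summability and the size of the tails.\<close>

lemma digit_le:
  assumes "i \<le> n"
  shows "digit i (j + k) \<le> (1 / 2) ^ j * (1 / of_int b ^ a k i)"
proof -
  have "digit i (j + k) \<le> 1 / of_int b ^ a (j + k) i"
    unfolding digit_def using u_over_v
    by (intro divide_right_mono) (auto intro!: power_le_one)
  also have "\<dots> \<le> 1 / of_int b ^ (j + a k i)"
    using a_add[OF assms, of j k] b_pow_mono by (intro divide_left_mono) auto
  also have "\<dots> = (1 / of_int b) ^ j * (1 / of_int b ^ a k i)"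
    by (simp add: power_add power_divide)
  also have "\<dots> \<le> (1 / 2) ^ j * (1 / of_int b ^ a k i)"
    using b by (intro mult_right_mono power_mono) (auto simp: field_simps)
  finally show ?thesis .
qed

lemma summable_digit_shift: "i \<le> n \<Longrightarrow> summable (\<lambda>j. digit i (j + k))"
  by (rule summable_comparison_test'[where g = "\<lambda>j. (1 / 2) ^ j * (1 / of_int b ^ a k i)" and N = 0])
     (use digit_le digit_pos in \<open>auto simp: less_imp_le intro!: summable_divide summable_geometric\<close>)

lemma summable_digit: "i \<le> n \<Longrightarrow> summable (digit i)"
  using summable_digit_shift[of i 0] by simp

lemma part_plus_tail: "i \<le> n \<Longrightarrow> coord i = part k i + tail k i"
  unfolding coord_def part_def tail_def using suminf_split_initial_segment[OF summable_digit, of i k]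
  by (simp add: algebra_simps)

lemma tail_bound:
  assumes "i \<le> n"
  shows "\<bar>tail k i\<bar> \<le> of_int b ^ L / of_int b ^ a k i"
proof -
  have "(\<Sum>j. digit i (j + k)) \<le> (\<Sum>j. (1 / 2) ^ j * (1 / of_int b ^ a k i))"
    using assms digit_le by (intro suminf_le summable_digit_shift summable_mult2 summable_geometric) auto
  also have "\<dots> = 2 * (1 / of_int b ^ a k i)"
    by (subst suminf_mult2[symmetric]) (auto simp: suminf_geometric intro!: summable_geometric)
  finally have "(\<Sum>j. digit i (j + k)) \<le> 2 / of_int b ^ a k i" by simp
  moreover have "0 \<le> (\<Sum>j. digit i (j + k))"
    using assms digit_pos by (intro suminf_nonneg summable_digit_shift) (auto intro: less_imp_le)
  ultimately have "\<bar>tail k i\<bar> \<le> \<bar>\<gamma>\<bar> * (2 / of_int b ^ a k i)"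
    unfolding tail_def abs_mult by (intro mult_left_mono) auto
  also have "\<dots> \<le> of_int b ^ L / of_int b ^ a k i"
    using divide_right_mono[OF L(3) b_pow_nonneg[of "a k i"]] by (simp add: mult.commute)
  finally show ?thesis .
qed

lemma tail_Suc: "i \<le> n \<Longrightarrow> tail k i = \<gamma> * digit i k + tail (Suc k) i"
  using part_plus_tail[of i k] part_plus_tail[of i "Suc k"] by (simp add: part_def algebra_simps)

section \<open>Clearing denominators and approximating the point\<close>

lemma digit_int:
  assumes "j \<le> k" "a j i \<le> d"
  shows "of_int (s * v ^ k * b ^ d) * (\<gamma> * digit i j) \<in> \<int>"
proof -
  have "of_int (s * v ^ k * b ^ d) * (\<gamma> * digit i j)
    = (of_int s * \<gamma>) * of_int (v ^ (k - j) * u ^ j * b ^ (d - a j i))"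
  proof -
    have "(of_int v :: real) ^ k = of_int v ^ (k - j) * of_int v ^ j"
      "(of_int b :: real) ^ d = of_int b ^ (d - a j i) * of_int b ^ a j i"
      using assms by (simp_all flip: power_add)
    then show ?thesis
      using u b by (simp add: digit_def power_divide)
  qed
  then show ?thesis using int by (metis Ints_mult Ints_of_int)
qed

lemma part_int:
  assumes "l \<le> k" "\<And>j. j < l \<Longrightarrow> a j i \<le> d"
  shows "of_int (s * v ^ k * b ^ d) * part l i \<in> \<int>"
proof -
  have "of_int (s * v ^ k * b ^ d) * part l i
    = (of_int s * p) * of_int (v ^ k * b ^ d) + (\<Sum>j<l. of_int (s * v ^ k * b ^ d) * (\<gamma> * digit i j))"
    by (simp add: part_def sum_distrib_left algebra_simps)
  then show ?thesis using assms int
    by (auto intro!: Ints_add Ints_sum digit_int intro: Ints_mult[OF _ Ints_of_int] simp del: of_int_mult)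
qed

lemma part_int_last:
  assumes "l \<le> k" "a (l - 1) i \<le> d" "i \<le> n"
  shows "of_int (s * v ^ k * b ^ d) * part l i \<in> \<int>"
proof (rule part_int)
  fix j assume "j < l"
  then have "a j i \<le> a (l - 1) i" using assms by (intro a_mono2) auto
  with assms show "a j i \<le> d" by simp
qed (use assms in auto)

text \<open>If \<open>q\<close> clears a partial sum, only \<open>q\<close> times the tail is left.
  Each coordinate may be cut at its own stage, which matters for denominators that contain only part
  of a stage.\<close>

lemma approx:
  fixes q :: int
  assumes "\<And>i. i \<le> n \<Longrightarrow> \<exists>k. d \<le> a k i \<and> of_int q * part k i \<in> \<int>" and q: "0 \<le> q"
  shows "dist_to_int (of_int q *\<^sub>R point) \<le> of_int q * of_int b ^ L / of_int b ^ d"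
proof (rule dist_to_int_le)
  fix i
  obtain k where k: "d \<le> a k (idx i)" "of_int q * part k (idx i) \<in> \<int>"
    using assms(1)[OF idx_le] by blast
  have "\<bar>(of_int q *\<^sub>R point) $ i - of_int q * part k (idx i)\<bar> = of_int q * \<bar>tail k (idx i)\<bar>"
    using q by (simp add: point_def part_plus_tail[of _ k] algebra_simps abs_mult)
  also have "\<dots> \<le> of_int q * (of_int b ^ L / of_int b ^ a k (idx i))"
    using q by (intro mult_left_mono tail_bound) auto
  also have "\<dots> \<le> of_int q * (of_int b ^ L / of_int b ^ d)"
    using q b_pow_mono[OF k(1)] by (intro mult_left_mono divide_left_mono) auto
  finally show "\<exists>z\<in>\<int>. \<bar>(of_int q *\<^sub>R point) $ i - z\<bar> \<le> of_int q * of_int b ^ L / of_int b ^ d"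
    using k(2) by auto
qed

text \<open>Closedness is used twice: iterates of \<open>g\<close> carry any point of
  \<open>C\<close> to the fixed point \<open>p\<close>, and the finite words applied to
  \<open>p\<close> then converge to the coordinate.\<close>

lemma point_component_in:
  assumes f: "\<And>z. f (p + z) = p + \<gamma> + of_int u / of_int v * z" and g: "\<And>z. g (p + z) = p + z / of_int b"
    and C: "f ` C \<subseteq> C" "g ` C \<subseteq> C" "closed C" "C \<noteq> {}"
  shows "point $ i \<in> C"
proof -
  obtain y where y: "y \<in> C" using C by blast
  have gn: "(g ^^ k) y = p + (y - p) / of_int b ^ k" for k
    by (induction k) (simp_all add: g mult.commute)
  have gC: "(g ^^ k) y \<in> C" for k
    using y C by (induction k) auto
  have "(\<lambda>k. (1 / of_int b :: real) ^ k) \<longlonglongrightarrow> 0"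
  proof (rule LIMSEQ_power_zero)
    show "norm (1 / of_int b :: real) < 1" using b by simp
  qed
  then have "(\<lambda>k. p + (y - p) * (1 / of_int b) ^ k) \<longlonglongrightarrow> p + (y - p) * 0"
    by (intro tendsto_add tendsto_mult tendsto_const)
  then have "(\<lambda>k. (g ^^ k) y) \<longlonglongrightarrow> p" by (simp add: gn power_divide)
  then have p: "p \<in> C" by (rule closed_sequentially[OF C(3) gC])
  have lim: "(\<lambda>k. p + \<gamma> * (\<Sum>j<k. digit (idx i) j)) \<longlonglongrightarrow> p + \<gamma> * (\<Sum>j. digit (idx i) j)"
    by (intro tendsto_intros summable_LIMSEQ summable_digit) simp
  have mem: "p + \<gamma> * (\<Sum>j<k. digit (idx i) j) \<in> C" for k
    unfolding digit_def
    by (rule affine_words_in_attractor[OF f g C(1,2) p]) (auto intro!: monoI a_mono2)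
  have "coord (idx i) \<in> C"
    unfolding coord_def by (rule closed_sequentially[OF C(3) mem lim])
  then show ?thesis by (simp add: point_def)
qed

section \<open>Sizes of denominators and errors as powers of the base\<close>

lemma b_real: "2 \<le> (of_int b :: real)"
  using b by linarith

lemma pow_eq_powr: "of_int b ^ k = of_int b powr real k"
  using b_real by (intro powr_realpow[symmetric]) simp

lemma b_powr_mono: "(x::real) \<le> y \<Longrightarrow> of_int b powr x \<le> of_int b powr y"
  using b_real by (intro powr_mono) auto

lemma v_pow_le: "(of_int v :: real) ^ k \<le> of_int b ^ (L * k)"
proof -
  have "(of_int v :: real) \<le> of_int b ^ L" using L(2) by (simp flip: of_int_power)
  then have "(of_int v :: real) ^ k \<le> (of_int b ^ L) ^ k"
    using u by (intro power_mono) auto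
  then show ?thesis by (simp add: power_mult)
qed

text \<open>The factors clear, in turn, \<open>p\<close> and \<open>\<gamma>\<close>, the slope
  powers up to exponent \<open>k\<close>, and the powers of \<open>b\<close> up to exponent
  \<open>d\<close>.\<close>

definition den :: "nat \<Rightarrow> nat \<Rightarrow> int" where
  "den k d = s * v ^ k * b ^ d"

lemma den_ge: "b ^ d \<le> den k d"
proof -
  have "1 * 1 * b ^ d \<le> s * v ^ k * b ^ d"
    using s u b by (intro mult_right_mono mult_mono) auto
  then show ?thesis by (simp add: den_def)
qed

lemma den_ge1: "1 \<le> den k d"
proof -
  have "1 \<le> b ^ d" using b by simp
  then show ?thesis using den_ge[of d k] by linarith
qed

lemma den_le: "of_int (den k d) \<le> of_int b powr (real d + L * (k + 1))"
proof -
  have "(of_int s :: real) \<le> of_int b ^ L" using L(1) by (simp flip: of_int_power)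
  then have "of_int (den k d) \<le> of_int b ^ L * of_int b ^ (L * k) * (of_int b ^ d :: real)"
    unfolding den_def of_int_mult of_int_power using v_pow_le s u
    by (intro mult_right_mono mult_mono) auto
  also have "\<dots> = of_int b powr (real d + L * (k + 1))"
    by (simp add: pow_eq_powr powr_add[symmetric] algebra_simps flip: power_add)
  finally show ?thesis .
qed

lemma den_part_int:
  assumes "l \<le> Suc k" "l \<le> k'" "a k i \<le> d" "i \<le> n"
  shows "of_int (den k' d) * part l i \<in> \<int>"
  unfolding den_def
proof (rule part_int_last)
  have "a (l - 1) i \<le> a k i" using assms by (intro a_mono2) auto
  with assms show "a (l - 1) i \<le> d" by simp
qed (use assms in auto)

text \<open>Two families of approximants suffice: the denominators after all digits of stage \<open>k\<close>, and
  after all digits of stage \<open>k + 1\<close> except the last.\<close>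

lemma approx_complete:
  "dist_to_int (of_int (den (Suc k) (a k n)) *\<^sub>R point)
    \<le> of_int (den (Suc k) (a k n)) * of_int b ^ L / of_int b ^ a (Suc k) 0"
proof (rule approx)
  fix i assume i: "i \<le> n"
  then show "\<exists>l. a (Suc k) 0 \<le> a l i \<and> of_int (den (Suc k) (a k n)) * part l i \<in> \<int>"
    by (intro exI[of _ "Suc k"] conjI den_part_int[of _ k]) (auto intro: a_mono)
qed (use den_ge1[of "Suc k" "a k n"] in simp)

lemma approx_partial:
  "dist_to_int (of_int (den (Suc (Suc k)) (a (Suc k) (n - 1))) *\<^sub>R point)
    \<le> of_int (den (Suc (Suc k)) (a (Suc k) (n - 1))) * of_int b ^ L / of_int b ^ a (Suc k) n"
proof (rule approx)
  fix i assume i: "i \<le> n"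
  show "\<exists>l. a (Suc k) n \<le> a l i \<and> of_int (den (Suc (Suc k)) (a (Suc k) (n - 1))) * part l i \<in> \<int>"
  \<comment> \<open>Only the last coordinate is cut before its digit of stage \<open>Suc k\<close>,
    and this dictates the error; the others are cut after it, and their tails start at stage
    \<open>Suc (Suc k)\<close>.\<close>
  proof (cases "i = n")
    case True
    have "a k n \<le> a (Suc k) (n - 1)"
      using growth_less[of k] a_mono[of 0 "n - 1" "Suc k"] by simp
    with True show ?thesis
      by (intro exI[of _ "Suc k"] conjI den_part_int[of _ k]) auto
  next
    case False
    have "a (Suc k) n \<le> a (Suc (Suc k)) i"
      using growth_less[of "Suc k"] a_mono[of 0 i "Suc (Suc k)"] i by simp
    moreover have "a (Suc k) i \<le> a (Suc k) (n - 1)"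
      using False i by (intro a_mono) auto
    ultimately show ?thesis using i
      by (intro exI[of _ "Suc (Suc k)"] conjI den_part_int[of _ "Suc k"]) auto
  qed
qed (use den_ge1 order_trans[OF zero_le_one] in auto)

text \<open>Logarithms to base \<open>b\<close> reduce the approximation condition to a linear
  inequality between exponents. Since \<open>t\<close> is nonnegative, \<open>Q\<close> may be
  replaced by its upper bound.\<close>

lemma approx_powr:
  fixes q :: int and x y t Q :: real
  assumes dist: "dist_to_int (of_int q *\<^sub>R point) \<le> of_int q * of_int b ^ L / of_int b ^ d"
    and q: "of_int q \<le> of_int b powr x" and Q: "0 < Q" "Q \<le> of_int b powr y"
    and t: "0 \<le> t" "x + L + t * y \<le> d"
  shows "dist_to_int (of_int q *\<^sub>R point) \<le> Q powr (- t)"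
proof -
  have "of_int q * of_int b ^ L / of_int b ^ d \<le> of_int b powr x * of_int b ^ L / of_int b ^ d"
    using q by (intro divide_right_mono mult_right_mono) auto
  also have "\<dots> = of_int b powr (x + L - d)"
    by (simp add: pow_eq_powr powr_add powr_diff)
  also have "\<dots> \<le> of_int b powr (y * (- t))"
    using t by (intro b_powr_mono) (simp add: algebra_simps)
  also have "\<dots> = (of_int b powr y) powr (- t)"
    by (simp add: powr_powr)
  also have "\<dots> \<le> Q powr (- t)"
    using Q t by (intro powr_mono2') auto
  finally show ?thesis using dist by linarith
qed

text \<open>This serves where only the powers of \<open>v\<close> have to be absorbed. Passing from
  \<open>k\<close> to \<open>Suc k\<close> is paid for by doubling the constant.\<close>

lemma growth_linear_eventually:
  fixes c :: real
  shows "\<forall>\<^sub>F k in sequentially. c * (real k + 1) \<le> a k 0"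
proof -
  have "\<forall>\<^sub>F k in sequentially. (2 * \<bar>c\<bar>) * (real (a k n) + real k + 1) \<le> a (Suc k) 0"
    by (rule growth_eventually)
  then have "\<forall>\<^sub>F k in sequentially. c * (real (Suc k) + 1) \<le> a (Suc k) 0"
  proof eventually_elim
    case (elim k)
    have "c * (real (Suc k) + 1) \<le> \<bar>c\<bar> * (2 * (real (a k n) + real k + 1))"
      by (intro mult_mono) auto
    also have "\<dots> = 2 * \<bar>c\<bar> * (real (a k n) + real k + 1)" by simp
    finally show ?case using elim by linarith
  qed
  then show ?thesis by (subst (asm) eventually_sequentially_Suc)
qed

section \<open>Liouville property and total irrationality\<close>

lemma liouville_point:
  assumes "totally_irrational point"
  shows "liouville point"
  unfolding liouville_def
proof (intro conjI allI)
  show "\<not> (\<forall>i. point $ i \<in> \<rat>)"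
  proof
    assume rat: "\<forall>i. point $ i \<in> \<rat>"
    fix i :: 'm
    have "axis i 1 \<bullet> point \<in> \<rat>" "(axis i 1 :: real ^ 'm) \<noteq> 0" "\<forall>j. (axis i 1 :: real ^ 'm) $ j \<in> \<rat>"
      using rat by (auto simp: inner_axis') (auto simp: axis_def vec_eq_iff)
    with assms show False unfolding totally_irrational_def by blast
  qed
next
  fix T :: real
  define t where "t = \<bar>T\<bar> + 1"
  have t: "0 < t" "T < t" by (auto simp: t_def)
  \<comment> \<open>The denominator \<open>q\<close> has size at most \<open>b powr y\<close> with
    \<open>y\<close> linear in \<open>a k n\<close> and \<open>k\<close>, while the error exponent
    \<open>a (Suc k) 0\<close> outgrows every multiple of that. The constant is read off from the
    required bound \<open>(1 + t) * y + L\<close>.\<close>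
  define c where "c = (1 + t) * (1 + 2 * L) + L"
  have "\<forall>\<^sub>F k in sequentially. c * (real (a k n) + real k + 1) \<le> a (Suc k) 0 \<and> 1 \<le> k"
    by (intro eventually_conj growth_eventually eventually_ge_at_top)
  then obtain k where k: "c * (real (a k n) + real k + 1) \<le> a (Suc k) 0" "1 \<le> k"
    using eventually_happens'[OF sequentially_bot] by blast
  define q where "q = den (Suc k) (a k n)"
  define y where "y = real (a k n) + L * (Suc k + 1)"
  \<comment> \<open>Here \<open>1 \<le> k\<close> enters: \<open>gap\<close> gives
    \<open>a k n >= k\<close>, so \<open>q\<close> is at least \<open>b\<close> and meets the bound
    2 in \<open>liouville\<close>.\<close>
  have "1 \<le> a k n"
    using gap[of "n - 1" k] n k(2) by simp
  then have "b ^ 1 \<le> b ^ a k n" using b by (intro power_increasing) auto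
  then have q2: "2 \<le> q" using b den_ge[of "a k n" "Suc k"] unfolding q_def by simp
  have "y \<le> (1 + 2 * L) * (real (a k n) + real k + 1)"
    unfolding y_def by (simp add: algebra_simps)
  then have "(1 + t) * y \<le> (1 + t) * ((1 + 2 * L) * (real (a k n) + real k + 1))"
    using t by (intro mult_left_mono) auto
  moreover have "real L * 1 \<le> L * (real (a k n) + real k + 1)"
    by (intro mult_left_mono) auto
  moreover have "c * (real (a k n) + real k + 1)
    = (1 + t) * ((1 + 2 * L) * (real (a k n) + real k + 1)) + L * (real (a k n) + real k + 1)"
    by (simp add: c_def algebra_simps)
  moreover have "(1 + t) * y = y + t * y"
    by (simp add: algebra_simps)
  ultimately have "y + L + t * y \<le> a (Suc k) 0"
    using k(1) by linarith
  moreover have q_le: "of_int q \<le> of_int b powr y"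
    using den_le[of "Suc k" "a k n"] by (simp only: q_def y_def)
  ultimately have "dist_to_int (of_int q *\<^sub>R point) \<le> of_int q powr (- t)"
    using q2 t by (intro approx_powr[OF approx_complete[of k, folded q_def] q_le _ q_le]) simp_all
  with t q2 show "\<exists>t>T. t > 0 \<and> (\<exists>q::int. 2 \<le> q \<and> dist_to_int (of_int q *\<^sub>R point) \<le> of_int q powr (- t))"
    by (intro exI[of _ t] conjI exI[of _ q])
qed

text \<open>
  After multiplication by the common denominator, a rational relation between the coordinates
  would have to hold for all late tails, hence for the \<open>k\<close>-th digits alone; but these have
  different orders of magnitude.
\<close>

lemma totally_irrational_point: "totally_irrational point"
  unfolding totally_irrational_def
proof
  assume "\<exists>(\<alpha> :: real ^ 'm) c. \<alpha> \<noteq> 0 \<and> (\<forall>i. \<alpha> $ i \<in> \<rat>) \<and> c \<in> \<rat> \<and> \<alpha> \<bullet> point = c"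
  then obtain \<alpha> :: "real ^ 'm" and c where \<alpha>: "\<alpha> \<noteq> 0" "\<And>i. \<alpha> $ i \<in> \<rat>" "c \<in> \<rat>" "\<alpha> \<bullet> point = c"
    by blast
  have "\<forall>x\<in>\<rat>. \<exists>M::int. 0 < M \<and> of_int M * x \<in> (\<int> :: real set)"
  proof
    fix x :: real assume "x \<in> \<rat>"
    then obtain r M where "0 < M" "x = of_int r / of_int M" by (elim Rats_cases')
    then show "\<exists>M::int. 0 < M \<and> of_int M * x \<in> \<int>" by (intro exI[of _ M]) auto
  qed
  then obtain D :: "real \<Rightarrow> int" where D: "\<And>x. x \<in> \<rat> \<Longrightarrow> 0 < D x \<and> of_int (D x) * x \<in> \<int>"
    by metis
  define M where "M = D c * (\<Prod>i\<in>UNIV. D (\<alpha> $ i))"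
  have M_pos: "0 < M"
    unfolding M_def using D \<alpha> by (intro mult_pos_pos prod_pos) auto
  have M_c: "of_int M * c \<in> \<int>"
  proof -
    have "of_int M * c = (of_int (D c) * c) * of_int (\<Prod>i\<in>UNIV. D (\<alpha> $ i))"
      by (simp add: M_def)
    then show ?thesis using D \<alpha>(3) by (metis Ints_mult Ints_of_int)
  qed
  have M_\<alpha>: "of_int M * \<alpha> $ i \<in> \<int>" for i
  proof -
    have "M = D (\<alpha> $ i) * (D c * (\<Prod>j\<in>UNIV - {i}. D (\<alpha> $ j)))"
      unfolding M_def by (subst prod.remove[of UNIV i]) auto
    then have "of_int M * \<alpha> $ i = (of_int (D (\<alpha> $ i)) * \<alpha> $ i) * of_int (D c * (\<Prod>j\<in>UNIV - {i}. D (\<alpha> $ j)))"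
      by simp
    then show ?thesis using D \<alpha>(2) by (metis Ints_mult Ints_of_int)
  qed
  define S where "S k = (\<Sum>i\<in>UNIV. \<alpha> $ i * tail k (idx i))" for k
  have S_part: "S k = c - (\<Sum>i\<in>UNIV. \<alpha> $ i * part k (idx i))" for k
  proof -
    have "\<alpha> \<bullet> point = (\<Sum>i\<in>UNIV. \<alpha> $ i * part k (idx i) + \<alpha> $ i * tail k (idx i))"
      by (simp add: inner_vec_def point_def part_plus_tail[of _ k] algebra_simps)
    then show ?thesis using \<alpha>(4) by (simp add: S_def sum.distrib)
  qed
  define q where "q k = den (Suc k) (a k n)" for k
  \<comment> \<open>The tail combination equals \<open>c\<close> minus the same combination of
    partial sums, so it is rational with denominator dividing \<open>M * q k\<close>. It is too
    small to be nonzero once \<open>k\<close> is large.\<close>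
  have int: "of_int (M * q k) * S (Suc k) \<in> \<int>" for k
  proof -
    have eq: "of_int (M * q k) * S (Suc k)
      = of_int (q k) * (of_int M * c) - (\<Sum>i\<in>UNIV. (of_int M * \<alpha> $ i) * (of_int (q k) * part (Suc k) (idx i)))"
      unfolding S_part by (simp add: algebra_simps sum_distrib_left)
    have qp: "of_int (q k) * part (Suc k) (idx i) \<in> \<int>" for i
      unfolding q_def by (rule den_part_int[of _ k]) (auto intro: a_mono)
    show ?thesis
      unfolding eq by (intro Ints_diff Ints_sum Ints_mult[OF Ints_of_int M_c] Ints_mult[OF M_\<alpha> qp])
  qed
  define A where "A = (\<Sum>i\<in>UNIV. \<bar>\<alpha> $ i\<bar>)"
  have S_le: "\<bar>S k\<bar> \<le> A * (of_int b ^ L / of_int b ^ a k 0)" for k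
  proof -
    have "\<bar>S k\<bar> \<le> (\<Sum>i\<in>UNIV. \<bar>\<alpha> $ i\<bar> * \<bar>tail k (idx i)\<bar>)"
      unfolding S_def by (rule order_trans[OF sum_abs]) (simp add: abs_mult)
    also have "\<dots> \<le> (\<Sum>i\<in>UNIV. \<bar>\<alpha> $ i\<bar> * (of_int b ^ L / of_int b ^ a k 0))"
    proof (intro sum_mono mult_left_mono)
      fix i
      have "\<bar>tail k (idx i)\<bar> \<le> of_int b ^ L / of_int b ^ a k (idx i)" by (rule tail_bound) simp
      also have "\<dots> \<le> of_int b ^ L / of_int b ^ a k 0"
        by (intro divide_left_mono b_pow_mono a_mono) auto
      finally show "\<bar>tail k (idx i)\<bar> \<le> of_int b ^ L / of_int b ^ a k 0" .
    qed auto
    finally show ?thesis by (simp only: A_def sum_distrib_right)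
  qed
  obtain e :: nat where e: "of_int M * A < of_int b ^ e"
    using real_arch_pow[of "of_int b" "of_int M * A"] b_real by auto
  have "\<forall>\<^sub>F k in sequentially. (1 + 3 * real L + e) * (real (a k n) + real k + 1) \<le> a (Suc k) 0"
    by (rule growth_eventually)
  then have S0: "\<forall>\<^sub>F k in sequentially. S (Suc k) = 0"
  proof eventually_elim
    case (elim k)
    have q: "0 < q k" using den_ge1[of "Suc k" "a k n"] by (simp add: q_def)
    have "\<bar>of_int (M * q k) * S (Suc k)\<bar> = of_int (q k) * (of_int M * \<bar>S (Suc k)\<bar>)"
      using M_pos q by (simp add: abs_mult)
    also have "\<dots> \<le> of_int (q k) * (of_int M * (A * (of_int b ^ L / of_int b ^ a (Suc k) 0)))"
      using M_pos q by (intro mult_left_mono S_le) auto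
    also have "\<dots> = of_int (q k) * ((of_int M * A) * (of_int b ^ L / of_int b ^ a (Suc k) 0))"
      by simp
    also have "\<dots> < of_int (q k) * (of_int b ^ e * (of_int b ^ L / of_int b ^ a (Suc k) 0))"
      using q e by (intro mult_strict_left_mono mult_strict_right_mono) auto
    also have "\<dots> \<le> of_int b powr (real (a k n) + L * (Suc k + 1)) * (of_int b ^ e * (of_int b ^ L / of_int b ^ a (Suc k) 0))"
      unfolding q_def by (intro mult_right_mono den_le) auto
    also have "\<dots> = of_int b powr (real (a k n) + L * (Suc k + 1) + e + L - a (Suc k) 0)"
      unfolding pow_eq_powr powr_add[symmetric] powr_diff[symmetric] by (simp add: algebra_simps)
    also have "\<dots> \<le> of_int b powr 0"
    proof (rule b_powr_mono)
      have "(1 + 3 * real L + e) * (real (a k n) + real k + 1) \<ge> real (a k n) + L * (Suc k + 1) + e + L"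
        by (simp add: algebra_simps)
      with elim show "real (a k n) + L * (Suc k + 1) + e + L - a (Suc k) 0 \<le> 0" by linarith
    qed
    finally have "\<bar>of_int (M * q k) * S (Suc k)\<bar> < 1" using b by simp
    then have "of_int (M * q k) * S (Suc k) = 0"
      by (rule Ints_nonzero_abs_less1[OF int])
    then show ?case using M_pos q by simp
  qed
  have "\<forall>\<^sub>F k in sequentially. S (Suc (Suc k)) = 0"
    using S0 by (subst eventually_sequentially_Suc)
  with S0 have digits0: "\<forall>\<^sub>F k in sequentially. (\<Sum>i\<in>UNIV. \<alpha> $ i / of_int b ^ a (Suc k) (idx i)) = 0"
  proof eventually_elim
    case (elim k)
    \<comment> \<open>Consecutive tails differ by one digit, and its factor
      \<open>\<gamma> * (u / v) ^ Suc k\<close> is common to all coordinates.\<close>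
    have "S (Suc k) - S (Suc (Suc k)) = (\<Sum>i\<in>UNIV. \<alpha> $ i * (\<gamma> * digit (idx i) (Suc k)))"
      unfolding S_def sum_subtractf[symmetric]
      by (intro sum.cong refl) (simp add: tail_Suc[of _ "Suc k"] algebra_simps)
    also have "\<dots> = \<gamma> * (of_int u / of_int v) ^ Suc k * (\<Sum>i\<in>UNIV. \<alpha> $ i / of_int b ^ a (Suc k) (idx i))"
      unfolding sum_distrib_left digit_def by (intro sum.cong refl) simp
    finally show ?case using elim \<gamma> u by simp
  qed
  \<comment> \<open>The participating coordinate with the smallest exponent dominates: by
    \<open>gap\<close> all others are smaller by a factor of at least \<open>b ^ Suc k\<close>, too
    much for fixed coefficients.\<close>
  obtain i0 where i0: "\<alpha> $ i0 \<noteq> 0" "\<And>i. \<alpha> $ i \<noteq> 0 \<Longrightarrow> idx i0 \<le> idx i"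
    using ex_has_least_nat[of "\<lambda>i. \<alpha> $ i \<noteq> 0" _ idx] \<alpha>(1) by (auto simp: vec_eq_iff)
  obtain e' :: nat where e': "A / \<bar>\<alpha> $ i0\<bar> < of_int b ^ e'"
    using real_arch_pow[of "of_int b" "A / \<bar>\<alpha> $ i0\<bar>"] b_real by auto
  have "\<forall>\<^sub>F k in sequentially. (\<Sum>i\<in>UNIV. \<alpha> $ i / of_int b ^ a (Suc k) (idx i)) = 0 \<and> e' \<le> k"
    using digits0 eventually_ge_at_top by (rule eventually_conj)
  then obtain k where k: "(\<Sum>i\<in>UNIV. \<alpha> $ i / of_int b ^ a (Suc k) (idx i)) = 0" "e' \<le> k"
    using eventually_happens'[OF sequentially_bot] by blast
  define a0 where "a0 = a (Suc k) (idx i0)"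
  have far: "a0 + Suc k \<le> a (Suc k) (idx i)" if "\<alpha> $ i \<noteq> 0" "i \<noteq> i0" for i
  proof -
    have "idx i \<noteq> idx i0" using idx that(2) by (auto simp: bij_betw_def inj_def)
    then have less: "Suc (idx i0) \<le> idx i" using i0(2)[OF that(1)] by simp
    then have "a0 + Suc k \<le> a (Suc k) (Suc (idx i0))"
      unfolding a0_def using idx_le[of i] by (intro gap) linarith
    also have "\<dots> \<le> a (Suc k) (idx i)" using less by (intro a_mono) auto
    finally show ?thesis .
  qed
  have "\<alpha> $ i0 / of_int b ^ a0 = - (\<Sum>i\<in>UNIV - {i0}. \<alpha> $ i / of_int b ^ a (Suc k) (idx i))"
    using k(1) by (subst (asm) sum.remove[of UNIV i0]) (auto simp: a0_def)
  then have "\<bar>\<alpha> $ i0\<bar> / of_int b ^ a0 = \<bar>\<Sum>i\<in>UNIV - {i0}. \<alpha> $ i / of_int b ^ a (Suc k) (idx i)\<bar>"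
    by (metis abs_divide abs_minus_cancel abs_of_pos b_pow_pos)
  also have "\<dots> \<le> (\<Sum>i\<in>UNIV - {i0}. \<bar>\<alpha> $ i\<bar> / of_int b ^ a (Suc k) (idx i))"
    by (rule order_trans[OF sum_abs]) simp
  also have "\<dots> \<le> (\<Sum>i\<in>UNIV - {i0}. \<bar>\<alpha> $ i\<bar> / of_int b ^ (a0 + Suc k))"
  proof (rule sum_mono)
    fix i assume "i \<in> UNIV - {i0}"
    then show "\<bar>\<alpha> $ i\<bar> / of_int b ^ a (Suc k) (idx i) \<le> \<bar>\<alpha> $ i\<bar> / of_int b ^ (a0 + Suc k)"
      using far[of i] by (cases "\<alpha> $ i = 0") (auto intro!: divide_left_mono b_pow_mono simp del: power_Suc)
  qed
  also have "\<dots> \<le> (\<Sum>i\<in>UNIV. \<bar>\<alpha> $ i\<bar> / of_int b ^ (a0 + Suc k))"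
    using b by (intro sum_mono2) auto
  also have "\<dots> = A / of_int b ^ Suc k / of_int b ^ a0"
    by (simp add: A_def sum_divide_distrib power_add mult_ac)
  finally have "\<bar>\<alpha> $ i0\<bar> \<le> A / of_int b ^ Suc k"
    unfolding divide_le_cancel using b_pow_pos[of a0] by blast
  then have *: "of_int b ^ Suc k * \<bar>\<alpha> $ i0\<bar> \<le> A"
    by (simp add: pos_le_divide_eq mult.commute del: power_Suc)
  have "A < of_int b ^ e' * \<bar>\<alpha> $ i0\<bar>" using e' i0(1) by (simp add: pos_divide_less_eq)
  also have "\<dots> \<le> of_int b ^ Suc k * \<bar>\<alpha> $ i0\<bar>"
    using k(2) by (intro mult_right_mono b_pow_mono) auto
  finally show False using * by linarith
qed

subsection \<open>The uniform exponent\<close>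

text \<open>Between \<open>N k\<close> and \<open>N (Suc k)\<close> the complete denominator
  \<open>N k\<close> is used until \<open>Q\<close> reaches the partial denominator
  \<open>N'\<close>, which then takes over. \<open>H1\<close> makes the first range work,
  \<open>H2\<close> the second.\<close>

lemma exponent_below_admissible:
  fixes t \<omega> :: real
  assumes t: "0 < t" "t < \<omega>"
    and H1: "\<And>t::real. t < \<omega> \<Longrightarrow> \<forall>\<^sub>F k in sequentially. t * a k (n - 1) \<le> a k 0"
    and H2: "\<And>t::real. t < \<omega> \<Longrightarrow> \<forall>\<^sub>F k in sequentially. t * a k n \<le> real (a k n) - a k (n - 1)"
  shows "\<forall>\<^sub>F Q in at_top. \<exists>q::int. 1 \<le> q \<and> of_int q \<le> Q \<and> dist_to_int (of_int q *\<^sub>R point) \<le> Q powr (- t)"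
proof -
  \<comment> \<open>The hypotheses are applied at \<open>r\<close> rather than \<open>t\<close>; the
    slack pays for the factors \<open>b ^ L\<close> and \<open>v ^ k\<close>. In the first range a
    share \<open>\<rho>\<close> of \<open>a (Suc k) 0\<close> is left over, in the second a share
    \<open>r - t\<close> of \<open>a (Suc k) n\<close>; \<open>c\<close> and \<open>c'\<close> are
    the losses divided by these.\<close>
  define r where "r = (t + \<omega>) / 2"
  have r: "t < r" "r < \<omega>" "0 < r" using t by (auto simp: r_def)
  define \<rho> where "\<rho> = 1 - t / r"
  have \<rho>: "0 < \<rho>" using r by (simp add: \<rho>_def)
  define c where "c = (1 + 3 * L + 3 * t * L) / \<rho>"
  define c' where "c' = (2 * L + 2 * t * L) / (r - t)"
  have "\<forall>\<^sub>F k in sequentially. c * (real (a k n) + real k + 1) \<le> a (Suc k) 0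
    \<and> c' * (real (Suc k) + 1) \<le> a (Suc k) 0
    \<and> r * a (Suc k) (n - 1) \<le> a (Suc k) 0
    \<and> r * a (Suc k) n \<le> real (a (Suc k) n) - a (Suc k) (n - 1)"
    by (intro eventually_conj growth_eventually iffD2[OF eventually_sequentially_Suc H1[OF r(2)]]
      iffD2[OF eventually_sequentially_Suc growth_linear_eventually] iffD2[OF eventually_sequentially_Suc H2[OF r(2)]])
  then obtain K where K: "\<And>k. K \<le> k \<Longrightarrow> c * (real (a k n) + real k + 1) \<le> a (Suc k) 0"
      "\<And>k. K \<le> k \<Longrightarrow> c' * (real (Suc k) + 1) \<le> a (Suc k) 0"
      "\<And>k. K \<le> k \<Longrightarrow> r * a (Suc k) (n - 1) \<le> a (Suc k) 0"
      "\<And>k. K \<le> k \<Longrightarrow> r * a (Suc k) n \<le> real (a (Suc k) n) - a (Suc k) (n - 1)"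
    unfolding eventually_sequentially by blast
  define N where "N k = den (Suc k) (a k n)" for k
  show ?thesis
    unfolding eventually_at_top_linorder
  proof (rule exI[of _ "of_int (N K)"], intro allI impI)
    fix Q assume Q: "real_of_int (N K) \<le> Q"
    have unbounded: "\<exists>j\<ge>K. Q < N j"
    proof -
      obtain j :: nat where j: "Q < j" using reals_Archimedean2 by blast
      define l where "l = max j K"
      have "Q < l" using j by (simp add: l_def)
      also have "real l \<le> a l n" using a_add[of n l 0] by simp
      also have "\<dots> < 2 ^ a l n" by (rule of_nat_less_two_power)
      also have "\<dots> \<le> of_int b ^ a l n" using b_real by (intro power_mono) auto
      also have "\<dots> \<le> N l" using den_ge[of "a l n" "Suc l"] by (simp add: N_def flip: of_int_power)
      finally show ?thesis by (intro exI[of _ l]) (simp add: l_def)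
    qed
    \<comment> \<open>The predecessor of the least such index brackets \<open>Q\<close> from below;
      it is still at least \<open>K\<close> because \<open>Q\<close> is at least
      \<open>N K\<close>.\<close>
    define j where "j = (LEAST j. K \<le> j \<and> Q < N j)"
    have j: "K \<le> j" "Q < N j"
      using LeastI_ex[OF unbounded] by (auto simp: j_def)
    with Q have "j \<noteq> K" by auto
    with j obtain k where k: "j = Suc k" "K \<le> k" by (cases j) auto
    have "\<not> (K \<le> k \<and> Q < N k)"
      using not_less_Least[of k "\<lambda>j. K \<le> j \<and> Q < N j"] k by (simp add: j_def)
    with k j have Q_k: "N k \<le> Q" "Q < N (Suc k)" by auto
    define A B D E where "A = real (a (Suc k) 0)" and "B = real (a (Suc k) (n - 1))"
      and "D = real (a (Suc k) n)" and "E = real (a k n)"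
    have E: "0 \<le> E" by (simp add: E_def)
    note K' = K[OF k(2), folded A_def B_def D_def E_def]
    have "A \<le> D" unfolding A_def D_def using a_mono[of 0 n "Suc k"] by simp
    have N_k: "N k \<le> of_int b powr (E + L * (k + 2))"
      using den_le[of "Suc k" "a k n"] by (simp add: N_def E_def)
    have N_Suc: "N (Suc k) \<le> of_int b powr (D + L * (k + 3))"
      using den_le[of "Suc (Suc k)" "a (Suc k) n"] by (simp add: N_def D_def numeral_3_eq_3)
    define N' where "N' = den (Suc (Suc k)) (a (Suc k) (n - 1))"
    have N': "N' \<le> of_int b powr (B + L * (k + 3))"
      using den_le[of "Suc (Suc k)" "a (Suc k) (n - 1)"] by (simp add: N'_def B_def numeral_3_eq_3)
    have ge1: "1 \<le> N k" "1 \<le> N'" using den_ge1 by (simp_all add: N_def N'_def)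
    have Q_pos: "0 < Q" using ge1(1) Q_k(1) by linarith
    show "\<exists>q::int. 1 \<le> q \<and> of_int q \<le> Q \<and> dist_to_int (of_int q *\<^sub>R point) \<le> Q powr (- t)"
    proof (cases "Q < N'")
      case True
      have "E + L * (k + 2) + L + t * (L * (k + 3)) \<le> (1 + 3 * L + 3 * t * L) * (E + k + 1)"
        using E t by (simp add: algebra_simps)
      also have "\<dots> = \<rho> * (c * (E + k + 1))"
        using \<rho> by (simp add: c_def)
      also have "\<dots> \<le> \<rho> * A"
        using K'(1) \<rho> by (intro mult_left_mono) auto
      finally have "E + L * (k + 2) + L + t * (L * (k + 3)) + (t / r) * A \<le> A"
        by (simp add: \<rho>_def algebra_simps)
      moreover have "(t / r) * (r * B) \<le> (t / r) * A"
        using K'(3) r t by (intro mult_left_mono) auto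
      ultimately have *: "(E + L * (k + 2)) + L + t * (B + L * (k + 3)) \<le> A"
        using r by (simp add: algebra_simps)
      have "dist_to_int (of_int (N k) *\<^sub>R point) \<le> Q powr (- t)"
        by (rule approx_powr[OF approx_complete[of k, folded N_def] N_k Q_pos _ _ *[unfolded A_def]])
           (use True N' t in auto)
      with ge1 Q_k show ?thesis by blast
    next
      case False
      have "L * (k + 3) + L + t * (L * (k + 3)) \<le> (2 * L + 2 * t * L) * (real (Suc k) + 1)"
        using t by (simp add: algebra_simps)
      also have "\<dots> = (r - t) * (c' * (real (Suc k) + 1))"
        using r by (simp add: c'_def)
      also have "\<dots> \<le> (r - t) * D"
        using K'(2) r \<open>A \<le> D\<close> by (intro mult_left_mono) auto
      finally have *: "(B + L * (k + 3)) + L + t * (D + L * (k + 3)) \<le> D"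
        using K'(4) by (simp add: algebra_simps)
      have "dist_to_int (of_int N' *\<^sub>R point) \<le> Q powr (- t)"
        by (rule approx_powr[OF approx_partial[of k, folded N'_def] N' Q_pos _ _ *[unfolded D_def]])
           (use Q_k N_Suc t in \<open>auto simp: D_def\<close>)
      with ge1 False show ?thesis by auto
    qed
  qed
qed

lemma omega_hat_ge:
  fixes \<omega> :: real
  assumes "0 < \<omega>"
    and "\<And>t::real. t < \<omega> \<Longrightarrow> \<forall>\<^sub>F k in sequentially. t * a k (n - 1) \<le> a k 0"
    and "\<And>t::real. t < \<omega> \<Longrightarrow> \<forall>\<^sub>F k in sequentially. t * a k n \<le> real (a k n) - a k (n - 1)"
  shows "ereal \<omega> \<le> omega_hat point"
proof (rule ccontr)
  assume "\<not> ereal \<omega> \<le> omega_hat point"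
  then obtain z where z: "omega_hat point < ereal z" "ereal z < ereal \<omega>"
    using ereal_dense2 by (metis not_le)
  \<comment> \<open>\<open>z\<close> may be nonpositive, whereas admissibility is established for
    positive exponents; the maximum is positive and still below \<open>\<omega>\<close>.\<close>
  have "ereal (max z (\<omega> / 2)) \<le> omega_hat point"
    unfolding omega_hat_def using assms z(2)
    by (intro Sup_upper imageI CollectI exponent_below_admissible[of _ \<omega>]) auto
  then have "ereal z \<le> omega_hat point"
    using order_trans[of "ereal z" "ereal (max z (\<omega> / 2))" "omega_hat point"] by simp
  with z(1) show False
    using leD by blast
qed

text \<open>
  If \<open>q\<close> is a good approximation slightly below \<open>b ^ a k n\<close>, then a nonzero multiple \<open>w\<close> of \<open>q\<close>
  that is not much larger has all \<open>w / b ^ a k i\<close> near integers. As the steps from \<open>a k i\<close> to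
  \<open>a k (i + 1)\<close> are short, \<open>w\<close> is divisible in turn by \<open>b ^ a k 0\<close>, \<dots>, \<open>b ^ a k n\<close>, but it is
  smaller than the last of these.
\<close>

lemma exponent_above_inadmissible:
  fixes t \<omega> :: real
  assumes t: "0 < \<omega>" "\<omega> < t"
    and H1: "\<And>t::real. \<omega> < t \<Longrightarrow> \<forall>\<^sub>F k in sequentially. a k 0 \<le> t * a k n"
    and H2: "\<And>t::real. \<omega> < t \<Longrightarrow> \<forall>\<^sub>F k in sequentially. \<forall>i<n. real (a k (Suc i)) - a k i \<le> t * a k n"
  shows "\<not> (\<forall>\<^sub>F Q in at_top. \<exists>q::int. 1 \<le> q \<and> of_int q \<le> Q \<and> dist_to_int (of_int q *\<^sub>R point) \<le> Q powr (- t))"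
proof
  assume ev: "\<forall>\<^sub>F Q in at_top. \<exists>q::int. 1 \<le> q \<and> of_int q \<le> Q \<and> dist_to_int (of_int q *\<^sub>R point) \<le> Q powr (- t)"
  define r where "r = (t + \<omega>) / 2"
  have r: "\<omega> < r" "r < t" "0 < r" using t by (auto simp: r_def)
  \<comment> \<open>The deficit below \<open>a (Suc k) n\<close> leaves room for the integer
    \<open>z\<close> by which \<open>q\<close> will be multiplied, so that the product stays below
    \<open>b ^ a (Suc k) n\<close>.\<close>
  define y where "y k = a (Suc k) n - (real (a k n) + L * (k + 4) + 1)" for k
  have y_ev: "\<forall>\<^sub>F k in sequentially. real k \<le> y k"
    using growth_eventually[of "2 + 4 * real L"]
  proof eventually_elim
    case (elim k)
    have "real (a (Suc k) 0) \<le> a (Suc k) n" using a_mono[of 0 n "Suc k"] by simp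
    moreover have "real k + (real (a k n) + L * (k + 4) + 1) \<le> (2 + 4 * real L) * (real (a k n) + real k + 1)"
      by (simp add: algebra_simps)
    ultimately show ?case using elim unfolding y_def by linarith
  qed
  have "filterlim (\<lambda>k. of_int b powr y k) at_top sequentially"
  proof (rule filterlim_at_top_mono[OF filterlim_real_sequentially])
    show "\<forall>\<^sub>F k in sequentially. real k \<le> of_int b powr y k"
      using y_ev
    proof eventually_elim
      case (elim k)
      have "real k \<le> 2 ^ k" by (rule less_imp_le[OF of_nat_less_two_power])
      also have "\<dots> \<le> of_int b ^ k" using b_real by (intro power_mono) auto
      also have "\<dots> \<le> of_int b powr y k" using elim unfolding pow_eq_powr by (rule b_powr_mono)
      finally show ?case .
    qed
  qed
  with ev have ev': "\<forall>\<^sub>F k in sequentially. \<exists>q::int. 1 \<le> q \<and> of_int q \<le> of_int b powr y k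
      \<and> dist_to_int (of_int q *\<^sub>R point) \<le> (of_int b powr y k) powr (- t)"
    by (rule eventually_compose_filterlim)
  \<comment> \<open>\<open>c\<close> controls the multiplied approximation error and
    \<open>c'\<close> the tail after stage \<open>Suc k\<close>. Each is pushed down to
    \<open>b powr (- r * D - 1)\<close>, so that their sum is at most
    \<open>b powr (- r * D)\<close>.\<close>
  define c where "c = ((1 + t) * (2 + 4 * L) + 2) / (t - r)"
  define c' where "c' = 3 + r + 2 * real L"
  have "\<forall>\<^sub>F k in sequentially.
      c' * (real (a (Suc k) n) + real (Suc k) + 1) \<le> a (Suc (Suc k)) 0
    \<and> a (Suc k) 0 \<le> r * a (Suc k) n
    \<and> (\<forall>i<n. real (a (Suc k) (Suc i)) - a (Suc k) i \<le> r * a (Suc k) n)"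
    using growth_eventually[of c'] H1[OF r(1)] H2[OF r(1)]
    by (subst eventually_sequentially_Suc) (intro eventually_conj)
  then have "\<forall>\<^sub>F k in sequentially. (\<exists>q::int. 1 \<le> q \<and> of_int q \<le> of_int b powr y k
      \<and> dist_to_int (of_int q *\<^sub>R point) \<le> (of_int b powr y k) powr (- t))
    \<and> c * (real (a k n) + real k + 1) \<le> a (Suc k) 0
    \<and> c' * (real (a (Suc k) n) + real (Suc k) + 1) \<le> a (Suc (Suc k)) 0
    \<and> a (Suc k) 0 \<le> r * a (Suc k) n
    \<and> (\<forall>i<n. real (a (Suc k) (Suc i)) - a (Suc k) i \<le> r * a (Suc k) n)"
    using ev' growth_eventually[of c] by eventually_elim blast
  then obtain k where "(\<exists>q::int. 1 \<le> q \<and> of_int q \<le> of_int b powr y k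
      \<and> dist_to_int (of_int q *\<^sub>R point) \<le> (of_int b powr y k) powr (- t))
    \<and> c * (real (a k n) + real k + 1) \<le> a (Suc k) 0
    \<and> c' * (real (a (Suc k) n) + real (Suc k) + 1) \<le> a (Suc (Suc k)) 0
    \<and> a (Suc k) 0 \<le> r * a (Suc k) n
    \<and> (\<forall>i<n. real (a (Suc k) (Suc i)) - a (Suc k) i \<le> r * a (Suc k) n)"
    using eventually_happens'[OF sequentially_bot] by blast
  then obtain q :: int where q: "1 \<le> q" "of_int q \<le> of_int b powr y k"
      "dist_to_int (of_int q *\<^sub>R point) \<le> (of_int b powr y k) powr (- t)"
    and k: "c * (real (a k n) + real k + 1) \<le> a (Suc k) 0"
      "c' * (real (a (Suc k) n) + real (Suc k) + 1) \<le> a (Suc (Suc k)) 0"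
      "a (Suc k) 0 \<le> r * a (Suc k) n"
      "\<And>i. i < n \<Longrightarrow> real (a (Suc k) (Suc i)) - a (Suc k) i \<le> r * a (Suc k) n"
    by blast
  define D E A' where "D = real (a (Suc k) n)" and "E = real (a k n)" and "A' = real (a (Suc (Suc k)) 0)"
  have a_D: "real (a (Suc k) 0) \<le> D" unfolding D_def using a_mono[of 0 n "Suc k"] by simp
  have "E \<le> D" "0 \<le> E" unfolding D_def E_def using a_mono2[of n k "Suc k"] by auto
  have yk: "y k = D - (E + L * (k + 4) + 1)" by (simp add: y_def D_def E_def)
  have "(1 + t) * (E + L * (k + 4) + 2) \<le> (1 + t) * ((2 + 4 * L) * (E + k + 1))"
    using t \<open>0 \<le> E\<close> by (intro mult_left_mono) (auto simp: algebra_simps)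
  then have "(1 + t) * (E + L * (k + 4) + 2) + 2 \<le> ((1 + t) * (2 + 4 * L) + 2) * (E + k + 1)"
    using \<open>0 \<le> E\<close> by (simp add: algebra_simps)
  also have "\<dots> = (t - r) * (c * (E + k + 1))"
    using r by (simp add: c_def)
  also have "\<dots> \<le> (t - r) * D"
    using k(1) r a_D unfolding E_def by (intro mult_left_mono) auto
  finally have "(1 + t) * (E + L * (k + 4) + 2) + 2 \<le> (t - r) * D" .
  moreover have "E + L * (k + 2) + 2 \<le> E + L * (k + 4) + 2"
    by (simp add: algebra_simps)
  ultimately have e1: "E + L * (k + 2) + 1 + y k * (- t) \<le> - r * D - 1"
    using t unfolding yk by (simp add: algebra_simps)
  have "y k + (E + L * (k + 2)) + L + r * D + 1 \<le> c' * (D + real (Suc k) + 1)"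
    unfolding yk c'_def using r \<open>E \<le> D\<close> \<open>0 \<le> E\<close> by (simp add: algebra_simps)
  then have e2: "y k + (E + L * (k + 2)) + L - A' \<le> - r * D - 1"
    using k(2) unfolding A'_def D_def by simp
  define h where "h = den (Suc k) (a k n)"
  have h: "1 \<le> h" "h \<le> of_int b powr (E + L * (k + 2))"
    using den_ge1 den_le[of "Suc k" "a k n"] by (auto simp: h_def E_def)
  \<comment> \<open>Multiplication by \<open>h\<close> makes the partial sums integral and turns the
    digit term of every coordinate \<open>j\<close> into \<open>z / b ^ a (Suc k) j\<close>, with
    the same nonzero integer \<open>z\<close>.\<close>
  define \<mu> where "\<mu> = (of_int u / of_int v :: real) ^ Suc k"
  have \<mu>: "0 < \<mu>" "\<mu> \<le> 1" unfolding \<mu>_def using u_over_v by (auto intro: power_le_one simp del: power_Suc)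
  have "of_int h * \<gamma> * \<mu> = (of_int s * \<gamma>) * of_int (u ^ Suc k * b ^ a k n)"
    using u by (simp add: h_def den_def \<mu>_def power_divide)
  then have "of_int h * \<gamma> * \<mu> \<in> \<int>" using int by (metis Ints_mult Ints_of_int)
  then obtain z where z: "of_int h * \<gamma> * \<mu> = of_int z" by (elim Ints_cases)
  have "z \<noteq> 0" using z h(1) \<gamma> \<mu>(1) by auto
  define w where "w = q * z"
  have "w \<noteq> 0" using q(1) \<open>z \<noteq> 0\<close> by (simp add: w_def)
  have "\<bar>of_int w\<bar> = of_int q * (of_int h * \<bar>\<gamma>\<bar> * \<mu>)"
    using q h \<mu> by (simp add: w_def abs_mult flip: z)
  also have "\<dots> \<le> of_int b powr y k * (of_int b powr (E + L * (k + 2)) * of_int b ^ L * 1)"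
    using q h \<mu> L(3) by (intro mult_mono) auto
  also have "\<dots> = of_int b powr (y k + (E + L * (k + 2)) + L)"
    by (simp only: pow_eq_powr powr_add mult.assoc mult_1_right)
  also have "\<dots> \<le> of_int b powr (D - 1)"
    unfolding yk by (intro b_powr_mono) (simp add: algebra_simps)
  also have "\<dots> < of_int b powr D" using b_real by (intro powr_less_mono) auto
  also have "\<dots> = of_int (b ^ a (Suc k) n)" by (simp add: D_def pow_eq_powr)
  finally have w_less: "\<bar>w\<bar> < b ^ a (Suc k) n" by linarith
  have near: "\<exists>z'\<in>\<int>. \<bar>of_int w / of_int b ^ a (Suc k) j - z'\<bar> < of_int b powr (- r * D)" if j: "j \<le> n" for j
  proof -
    obtain i where i: "idx i = j" using idx j by (metis atMost_iff bij_betw_iff_bijections)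
    \<comment> \<open>The factor 2 makes the bound strict, so that an integer point can be taken
      from the infimum.\<close>
    have "dist_to_int (of_int q *\<^sub>R point) < 2 * (of_int b powr y k) powr (- t)"
    proof -
      have "0 < (of_int b powr y k) powr (- t)" using b by simp
      with q(3) show ?thesis by linarith
    qed
    from dist_to_int_lessD[OF this, of i] obtain z0 where z0: "z0 \<in> \<int>" "\<bar>of_int q * coord j - z0\<bar> < 2 * (of_int b powr y k) powr (- t)"
      by (auto simp: point_def i)
    define z' where "z' = of_int h * z0 - of_int q * (of_int h * part (Suc k) j)"
    have hp: "of_int h * part (Suc k) j \<in> \<int>"
      unfolding h_def using j by (intro den_part_int[of _ k]) (auto intro: a_mono)
    then have z': "z' \<in> \<int>" unfolding z'_def
      by (intro Ints_diff Ints_mult[OF Ints_of_int z0(1)] Ints_mult[OF Ints_of_int hp])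
    have "coord j = part (Suc k) j + \<gamma> * digit j (Suc k) + tail (Suc (Suc k)) j"
      using j by (simp add: part_plus_tail[of _ "Suc k"] tail_Suc[of _ "Suc k"])
    moreover have "of_int w / of_int b ^ a (Suc k) j = of_int q * of_int h * (\<gamma> * digit j (Suc k))"
      by (simp add: w_def digit_def \<mu>_def flip: z)
    ultimately have "of_int w / of_int b ^ a (Suc k) j - z'
      = of_int h * (of_int q * coord j - z0) - of_int q * (of_int h * tail (Suc (Suc k)) j)"
      by (simp add: z'_def algebra_simps)
    then have "\<bar>of_int w / of_int b ^ a (Suc k) j - z'\<bar>
      \<le> \<bar>of_int h * (of_int q * coord j - z0)\<bar> + \<bar>of_int q * (of_int h * tail (Suc (Suc k)) j)\<bar>"
      by linarith
    also have "\<dots> = of_int h * \<bar>of_int q * coord j - z0\<bar> + of_int q * (of_int h * \<bar>tail (Suc (Suc k)) j\<bar>)"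
      using h(1) q(1) by (simp add: abs_mult)
    also have "\<dots> < of_int h * (2 * (of_int b powr y k) powr (- t))
        + of_int q * (of_int h * (of_int b ^ L / of_int b ^ a (Suc (Suc k)) 0))"
    proof (intro add_less_le_mono mult_strict_left_mono mult_left_mono z0)
      have "\<bar>tail (Suc (Suc k)) j\<bar> \<le> of_int b ^ L / of_int b ^ a (Suc (Suc k)) j"
        using j by (rule tail_bound)
      also have "\<dots> \<le> of_int b ^ L / of_int b ^ a (Suc (Suc k)) 0"
        using j by (intro divide_left_mono b_pow_mono a_mono) auto
      finally show "\<bar>tail (Suc (Suc k)) j\<bar> \<le> of_int b ^ L / of_int b ^ a (Suc (Suc k)) 0" .
    qed (use h(1) q(1) in auto)
    also have "\<dots> \<le> of_int b powr (E + L * (k + 2)) * (of_int b powr 1 * of_int b powr (y k * (- t)))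
        + of_int b powr y k * (of_int b powr (E + L * (k + 2)) * (of_int b powr L / of_int b powr A'))"
      using h q b_real unfolding powr_powr pow_eq_powr A'_def
      by (intro add_mono mult_mono) auto
    also have "\<dots> = of_int b powr (E + L * (k + 2) + 1 + y k * (- t)) + of_int b powr (y k + (E + L * (k + 2)) + L - A')"
      by (simp only: powr_add powr_diff mult.assoc times_divide_eq_right)
    also have "\<dots> \<le> of_int b powr (- r * D - 1) + of_int b powr (- r * D - 1)"
      by (intro add_mono b_powr_mono e1 e2)
    also have "\<dots> = 2 * of_int b powr (- r * D) / of_int b"
      using b_real by (simp add: powr_diff)
    also have "\<dots> \<le> of_int b powr (- r * D)"
      using b_real by (simp add: divide_le_eq mult.commute mult_left_mono)
    finally show ?thesis using z' by blast
  qed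
  have step: "b ^ a (Suc k) j dvd w" if "j \<le> n" "x \<le> a (Suc k) j" "b ^ x dvd w" "real (a (Suc k) j) - x \<le> r * D" for j x
  proof -
    obtain z' where z': "z' \<in> \<int>" "\<bar>of_int w / of_int b ^ a (Suc k) j - z'\<bar> < of_int b powr (- r * D)"
      using near \<open>j \<le> n\<close> by blast
    have "of_int b powr (- r * D) \<le> of_int b powr (- real (a (Suc k) j - x))"
      using that by (intro b_powr_mono) (simp add: of_nat_diff)
    also have "\<dots> = 1 / of_int b ^ (a (Suc k) j - x)"
      by (simp add: pow_eq_powr powr_minus_divide)
    finally show ?thesis
      using b z' by (intro pow_dvd_if_near_int[OF _ that(2,3) z'(1)]) simp_all
  qed
  have "b ^ a (Suc k) j dvd w" if "j \<le> n" for j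
    using that
  proof (induction j)
    case 0
    \<comment> \<open>The first jump starts from the trivial divisor \<open>b ^ 0\<close>; this is
      why \<open>a k 0\<close> itself counts among the steps.\<close>
    show ?case by (rule step[of _ 0]) (use k(3) in \<open>simp_all add: D_def\<close>)
  next
    case (Suc j)
    have "b ^ a (Suc k) j dvd w" using Suc by simp
    then show ?case
      by (rule step[OF Suc.prems, rotated]) (use Suc.prems k(4)[of j] gap[of j "Suc k"] in \<open>simp_all add: D_def\<close>)
  qed
  from this[of n] have "b ^ a (Suc k) n \<le> \<bar>w\<bar>"
    using \<open>w \<noteq> 0\<close> by (intro zdvd_imp_le) auto
  with w_less show False by simp
qed

lemma omega_hat_le:
  fixes \<omega> :: real
  assumes "0 < \<omega>"
    and "\<And>t::real. \<omega> < t \<Longrightarrow> \<forall>\<^sub>F k in sequentially. a k 0 \<le> t * a k n"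
    and "\<And>t::real. \<omega> < t \<Longrightarrow> \<forall>\<^sub>F k in sequentially. \<forall>i<n. real (a k (Suc i)) - a k i \<le> t * a k n"
  shows "omega_hat point \<le> ereal \<omega>"
  unfolding omega_hat_def
proof (rule Sup_least)
  fix e assume "e \<in> ereal ` {t. \<forall>\<^sub>F Q in at_top. \<exists>q::int. 1 \<le> q \<and> of_int q \<le> Q \<and> dist_to_int (of_int q *\<^sub>R point) \<le> Q powr (- t)}"
  then obtain t where "e = ereal t" "\<forall>\<^sub>F Q in at_top. \<exists>q::int. 1 \<le> q \<and> of_int q \<le> Q \<and> dist_to_int (of_int q *\<^sub>R point) \<le> Q powr (- t)"
    by blast
  with exponent_above_inadmissible[OF assms(1) _ assms(2,3), of t] show "e \<le> ereal \<omega>"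
    by (cases "t \<le> \<omega>") auto
qed

end

section \<open>Choice of the exponents\<close>

text \<open>\<open>\<Phi> k A i\<close> stands for the \<open>i\<close>-th exponent of stage
  \<open>k\<close> when the first one is \<open>A\<close>; the recursion starts each stage far
  beyond the last exponent of the previous one. The quadratic bound makes shifts linear in
  \<open>k\<close> negligible.\<close>

lemma ex_lacunary_sequence:
  fixes \<Phi> :: "nat \<Rightarrow> nat \<Rightarrow> nat \<Rightarrow> nat"
  obtains A :: "nat \<Rightarrow> nat"
  where "\<And>k. A (Suc k) = Suc k * (\<Phi> k (A k) n + Suc k)" "\<And>k. k * k \<le> A k" "\<And>k. 1 \<le> A k"
proof -
  define A where "A = rec_nat 1 (\<lambda>k x. Suc k * (\<Phi> k x n + Suc k))"
  have A0: "A 0 = 1" and A: "\<And>k. A (Suc k) = Suc k * (\<Phi> k (A k) n + Suc k)" by (simp_all add: A_def)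
  have "k * k \<le> A k \<and> 1 \<le> A k" for k
  proof (cases k)
    case (Suc j)
    have "Suc j * Suc j \<le> A (Suc j)" unfolding A by (intro mult_le_mono) auto
    moreover have "1 \<le> Suc j * Suc j" by simp
    ultimately show ?thesis unfolding Suc by (metis order_trans)
  qed (simp add: A0)
  with that A show thesis by blast
qed

text \<open>
  For \<open>\<omega> < 1\<close> the exponents of stage \<open>k\<close> are \<open>A, 2 A, \<dots>, n A\<close> and \<open>n A / (1 - \<omega>)\<close>. For \<open>\<omega> = 1\<close> all but the
  last are \<open>A + o(A)\<close>, and the last is of larger order.
\<close>

lemma ex_exponents:
  fixes \<omega> :: real
  assumes n: "1 \<le> n" and \<omega>: "\<omega> \<in> {1 / (real n + 1) .. 1 / n} \<union> {1}"
  obtains a :: "nat \<Rightarrow> nat \<Rightarrow> nat"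
  where "\<And>k i. i < n \<Longrightarrow> a k i + k \<le> a k (Suc i)"
    and "\<And>k. Suc k * (a k n + Suc k) \<le> a (Suc k) 0"
    and "\<And>t::real. t < \<omega> \<Longrightarrow> \<forall>\<^sub>F k in sequentially. t * a k (n - 1) \<le> a k 0"
    and "\<And>t::real. t < \<omega> \<Longrightarrow> \<forall>\<^sub>F k in sequentially. t * a k n \<le> real (a k n) - a k (n - 1)"
    and "\<And>t::real. \<omega> < t \<Longrightarrow> \<forall>\<^sub>F k in sequentially. a k 0 \<le> t * a k n"
    and "\<And>t::real. \<omega> < t \<Longrightarrow> \<forall>\<^sub>F k in sequentially. \<forall>i<n. real (a k (Suc i)) - a k i \<le> t * a k n"
proof (cases "\<omega> = 1")
  case False
  with \<omega> n have lower: "1 / (real n + 1) \<le> \<omega>" and upper: "\<omega> \<le> 1 / n" by auto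
  have "\<omega> \<le> 1" using order_trans[OF upper] n by simp
  with False have lt1: "0 < 1 - \<omega>" by simp
  have pos: "0 < \<omega>" by (rule less_le_trans[OF _ lower]) simp
  have lower': "1 - \<omega> \<le> n * \<omega>" using lower by (simp add: field_simps)
  have upper': "n * \<omega> \<le> 1" using upper n by (simp add: field_simps)
  \<comment> \<open>The last exponent \<open>D\<close> solves
    \<open>D - n * A = \<omega> * D\<close>, rounded up. Rounding up keeps \<open>D_lower\<close>
    exact and costs at most 1 in \<open>D_upper\<close>.\<close>
  define \<Phi> where "\<Phi> k A i = (if i < n then (i + 1) * A else nat \<lceil>n * A / (1 - \<omega>)\<rceil>)" for k A i :: nat
  obtain A where A: "\<And>k. A (Suc k) = Suc k * (\<Phi> k (A k) n + Suc k)" "\<And>k. k * k \<le> A k" "\<And>k. 1 \<le> A k"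
    using ex_lacunary_sequence[of \<Phi> n] by blast
  have A_ge: "k \<le> A k" for k using A(2)[of k] by (cases k) auto
  define D where "D k = \<Phi> k (A k) n" for k
  have D_eq: "real (D k) = of_int \<lceil>n * A k / (1 - \<omega>)\<rceil>" for k
  proof -
    have "0 \<le> n * A k / (1 - \<omega>)" using lt1 by simp
    then have "0 \<le> \<lceil>n * A k / (1 - \<omega>)\<rceil>" by linarith
    then show ?thesis by (simp add: D_def \<Phi>_def)
  qed
  have D_lower: "n * A k \<le> (1 - \<omega>) * D k" for k
  proof -
    have "n * A k / (1 - \<omega>) \<le> D k" unfolding D_eq by linarith
    then show ?thesis using lt1 by (simp add: pos_divide_le_eq mult.commute)
  qed
  have D_upper: "(1 - \<omega>) * D k \<le> n * A k + 1" for k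
  proof -
    have "D k \<le> n * A k / (1 - \<omega>) + 1" unfolding D_eq by linarith
    then have "(1 - \<omega>) * D k \<le> (1 - \<omega>) * (n * A k / (1 - \<omega>) + 1)"
      using lt1 by (intro mult_left_mono) auto
    also have "\<dots> = n * A k + (1 - \<omega>)" using lt1 by (simp add: distrib_left)
    finally show ?thesis using pos by simp
  qed
  have A_D: "A k \<le> \<omega> * D k" for k
  proof -
    have "(1 - \<omega>) * A k \<le> (n * \<omega>) * A k" using lower' by (intro mult_right_mono) auto
    also have "\<dots> = \<omega> * (n * A k)" by simp
    also have "\<dots> \<le> \<omega> * ((1 - \<omega>) * D k)" using D_lower pos by (intro mult_left_mono) auto
    finally have "(1 - \<omega>) * A k \<le> (1 - \<omega>) * (\<omega> * D k)" by (simp add: mult_ac)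
    then show ?thesis using lt1 by (simp add: mult_le_cancel_left_pos)
  qed
  have D_ge: "n * A k + A k \<le> D k" for k
  proof -
    have "real (n * A k + A k) \<le> (1 - \<omega>) * D k + \<omega> * D k" using D_lower[of k] A_D[of k] by simp
    also have "\<dots> = D k" by (simp add: algebra_simps)
    finally show ?thesis by (simp only: of_nat_le_iff)
  qed
  define a where "a k i = \<Phi> k (A k) i" for k i
  have a_less: "a k i = (i + 1) * A k" if "i < n" for k i using that by (simp add: a_def \<Phi>_def)
  have a_n: "a k n = D k" for k by (simp add: a_def D_def)
  have a_0: "a k 0 = A k" and a_n1: "a k (n - Suc 0) = n * A k" for k using n by (simp_all add: a_less)
  show thesis
  proof (rule that)
    show "a k i + k \<le> a k (Suc i)" if "i < n" for k i
    proof (cases "Suc i < n")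
      case True
      then show ?thesis using A_ge[of k] that by (simp add: a_less)
    next
      case False
      with that have "Suc i = n" by simp
      then show ?thesis using A_ge[of k] D_ge[of k] that by (simp add: a_less a_n)
    qed
    show "Suc k * (a k n + Suc k) \<le> a (Suc k) 0" for k
      by (simp only: a_0[of "Suc k"] A(1)[of k] a_def[of k n] le_refl)
    show "\<forall>\<^sub>F k in sequentially. t * a k (n - 1) \<le> a k 0" if "t < \<omega>" for t :: real
    proof (intro always_eventually allI)
      fix k
      have "t * (n * A k) \<le> \<omega> * (n * A k)" using that by (intro mult_right_mono) auto
      also have "\<dots> = (n * \<omega>) * A k" by simp
      also have "\<dots> \<le> 1 * real (A k)" using upper' by (intro mult_right_mono) auto
      finally show "t * a k (n - 1) \<le> a k 0" by (simp add: a_0 a_n1)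
    qed
    show "\<forall>\<^sub>F k in sequentially. t * a k n \<le> real (a k n) - a k (n - 1)" if "t < \<omega>" for t :: real
    proof (intro always_eventually allI)
      fix k
      have "t * D k \<le> \<omega> * D k" using that by (intro mult_right_mono) auto
      then show "t * a k n \<le> real (a k n) - a k (n - 1)"
        using D_lower[of k] by (simp add: a_n a_n1 algebra_simps)
    qed
    show "\<forall>\<^sub>F k in sequentially. a k 0 \<le> t * a k n" if "\<omega> < t" for t :: real
    proof (intro always_eventually allI)
      fix k
      have "\<omega> * D k \<le> t * D k" using that by (intro mult_right_mono) auto
      then show "a k 0 \<le> t * a k n" using A_D[of k] by (simp add: a_n a_0)
    qed
    show "\<forall>\<^sub>F k in sequentially. \<forall>i<n. real (a k (Suc i)) - a k i \<le> t * a k n" if t: "\<omega> < t" for t :: real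
    proof -
      \<comment> \<open>From here on \<open>(t - \<omega>) * D k\<close> covers the rounding error 1
        in the last step.\<close>
      obtain K :: nat where K: "1 / (t - \<omega>) \<le> K" using real_arch_simple by blast
      have "real (a k (Suc i)) - a k i \<le> t * a k n" if k: "K \<le> k" and i: "i < n" for k i
      proof -
        have "\<omega> * D k \<le> t * D k" using t by (intro mult_right_mono) auto
        with A_D[of k] have small: "A k \<le> t * D k" by simp
        have "k \<le> D k" using A_ge[of k] D_ge[of k] by simp
        then have "1 / (t - \<omega>) \<le> D k" using K k by linarith
        then have big: "1 \<le> (t - \<omega>) * D k" using t by (simp add: pos_divide_le_eq mult.commute)
        show ?thesis
        proof (cases "Suc i < n")
          case True
          then show ?thesis using small i by (simp add: a_less a_n algebra_simps)
        next
          case False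
          with i have "Suc i = n" by simp
          then have "i = n - 1" by simp
          then show ?thesis using D_upper[of k] big \<open>Suc i = n\<close> by (simp add: a_n a_n1 algebra_simps)
        qed
      qed
      then show ?thesis unfolding eventually_sequentially by blast
    qed
  qed
next
  case True
  \<comment> \<open>Spacing \<open>k\<close> is the least that \<open>gap\<close> permits and is
    negligible against \<open>A >= k * k\<close>. The factor \<open>k + 1\<close> makes all earlier
    exponents a vanishing fraction of the last.\<close>
  define \<Phi> where "\<Phi> k A i = (if i < n then A + i * k else (k + 1) * (A + n * k))" for k A i :: nat
  obtain A where A: "\<And>k. A (Suc k) = Suc k * (\<Phi> k (A k) n + Suc k)" "\<And>k. k * k \<le> A k" "\<And>k. 1 \<le> A k"
    using ex_lacunary_sequence[of \<Phi> n] by blast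
  define a where "a k i = \<Phi> k (A k) i" for k i
  have a_less: "a k i = A k + i * k" if "i < n" for k i using that by (simp add: a_def \<Phi>_def)
  have a_n: "a k n = (k + 1) * (A k + n * k)" for k by (simp add: a_def \<Phi>_def)
  have a_0: "a k 0 = A k" for k using n by (simp add: a_less)
  have le: "a k i \<le> A k + n * k" if "i < n" for k i
    using that by (simp add: a_less)
  have n_ge: "A k + n * k \<le> a k n" for k by (simp add: a_n)
  have le_n: "a k i \<le> a k n" if "i \<le> n" for k i
    using that le[of i k] n_ge[of k] by (cases "i = n") auto
  \<comment> \<open>For \<open>\<omega> = 1\<close> both upper conditions follow from this, since no
    exponent or step exceeds \<open>a k n\<close>.\<close>
  have scale: "real (a k n) \<le> t * a k n" if "1 < t" for k and t :: real
    using that mult_right_mono[of 1 t "real (a k n)"] by simp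
  show thesis
  proof (rule that)
    show "a k i + k \<le> a k (Suc i)" if "i < n" for k i
    proof (cases "Suc i < n")
      case True
      then show ?thesis using that by (simp add: a_less)
    next
      case False
      with that have "Suc i = n" by simp
      moreover from this have "a k i + k = A k + n * k" using that by (auto simp: a_less)
      ultimately show ?thesis using n_ge[of k] by simp
    qed
    show "Suc k * (a k n + Suc k) \<le> a (Suc k) 0" for k
      by (simp only: a_0[of "Suc k"] A(1)[of k] a_def[of k n] le_refl)
    show "\<forall>\<^sub>F k in sequentially. t * a k (n - 1) \<le> a k 0" if t: "t < \<omega>" for t :: real
    proof -
      have t1: "0 < 1 - t" using t True by simp
      obtain K :: nat where K: "\<bar>t\<bar> * n / (1 - t) \<le> K" using real_arch_simple by blast
      have "t * a k (n - 1) \<le> a k 0" if k: "K \<le> k" for k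
      proof -
        have "\<bar>t\<bar> * n / (1 - t) \<le> k" using K k by linarith
        then have "\<bar>t\<bar> * n \<le> (1 - t) * k" using t1 by (simp add: pos_divide_le_eq mult.commute)
        then have "\<bar>t\<bar> * n * k \<le> (1 - t) * k * k" by (intro mult_right_mono) auto
        also have "\<dots> = (1 - t) * real (k * k)" by simp
        also have "\<dots> \<le> (1 - t) * A k" using A(2)[of k] t1 by (intro mult_left_mono) (simp_all only: of_nat_le_iff less_imp_le)
        finally have *: "\<bar>t\<bar> * n * k \<le> (1 - t) * A k" .
        have "t * real ((n - 1) * k) \<le> \<bar>t\<bar> * real (n * k)" by (intro mult_mono) (auto simp: mult_right_mono)
        then have "t * (A k + real ((n - 1) * k)) \<le> A k" using * by (simp add: algebra_simps)
        then show ?thesis using n by (simp add: a_less a_0)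
      qed
      then show ?thesis unfolding eventually_sequentially by blast
    qed
    show "\<forall>\<^sub>F k in sequentially. t * a k n \<le> real (a k n) - a k (n - 1)" if t: "t < \<omega>" for t :: real
    proof -
      have t1: "0 < 1 - t" using t True by simp
      obtain K :: nat where K: "1 / (1 - t) \<le> K" using real_arch_simple by blast
      have "t * a k n \<le> real (a k n) - a k (n - 1)" if k: "K \<le> k" for k
      proof -
        have "1 / (1 - t) \<le> real (k + 1)" using K k by simp
        then have "1 \<le> (1 - t) * real (k + 1)" using t1 by (simp add: pos_divide_le_eq mult.commute)
        then have "1 * real (A k + n * k) \<le> (1 - t) * real (k + 1) * real (A k + n * k)"
          by (intro mult_right_mono) auto
        also have "\<dots> = (1 - t) * a k n" unfolding a_n by (simp only: of_nat_mult mult.assoc)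
        finally have "real (A k + n * k) \<le> (1 - t) * a k n" by simp
        moreover have "real (a k (n - 1)) \<le> real (A k + n * k)"
          using le[of "n - 1" k] n by (simp only: of_nat_le_iff)
        ultimately show ?thesis by (simp add: algebra_simps)
      qed
      then show ?thesis unfolding eventually_sequentially by blast
    qed
    show "\<forall>\<^sub>F k in sequentially. a k 0 \<le> t * a k n" if "\<omega> < t" for t :: real
    proof (intro always_eventually allI)
      fix k
      show "a k 0 \<le> t * a k n" using that True le_n[of 0 k] scale[of t k] by simp
    qed
    show "\<forall>\<^sub>F k in sequentially. \<forall>i<n. real (a k (Suc i)) - a k i \<le> t * a k n" if "\<omega> < t" for t :: real
    proof (intro always_eventually allI impI)
      fix k i assume "i < n"
      then show "real (a k (Suc i)) - a k i \<le> t * a k n"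
        using that True le_n[of "Suc i" k] scale[of t k] by simp
    qed
  qed
qed

section \<open>Application to the attractor\<close>

lemma ex_power_bound:
  fixes x :: real
  assumes "1 < x"
  obtains L :: nat where "y \<le> x ^ L" "z \<le> x ^ L" "w \<le> x ^ L"
proof -
  obtain L where "max y (max z w) < x ^ L" using real_arch_pow[OF assms] by blast
  then show thesis by (intro that[of L]) auto
qed

theorem theorem3:
  fixes u1 b1 b2 s1 s2 r1 r2 :: int
    and f g :: "real \<Rightarrow> real"
    and C :: "real set"
    and K :: "(real ^ 'm) set"
  assumes "u1 \<ge> 1" "b1 \<ge> 2" "b2 \<ge> 2" "s1 \<ge> 1" "s2 \<ge> 1"
    and "u1 < b1"
    and "gcd r1 s1 = 1" "gcd r2 s2 = 1"
    and f: "f = (\<lambda>x. of_int u1 / of_int b1 * x + of_int r1 / of_int s1)"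
    and g: "g = (\<lambda>x. 1 / of_int b2 * x + of_int r2 / of_int s2)"
    and fixed_points: "real_of_int (b1 * r1) / real_of_int ((b1 - u1) * s1)
           \<noteq> real_of_int (b2 * r2) / real_of_int ((b2 - 1) * s2)"
    and C: "C = attractor f g"
    and m: "CARD('m) \<ge> 2"
    and K: "K = {\<xi>. \<forall>i. \<xi> $ i \<in> C}"
  shows "(\<forall>\<omega> \<in> {1 / real CARD('m) .. 1 / (real CARD('m) - 1)} \<union> {1}.
            \<exists>\<xi> \<in> K. totally_irrational \<xi> \<and> liouville \<xi> \<and> omega_hat \<xi> = ereal \<omega>)
       \<and> ereal ` ({1 / real CARD('m) .. 1 / (real CARD('m) - 1)} \<union> {1})
            \<subseteq> omega_hat ` {\<xi> \<in> K. totally_irrational \<xi>}"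
proof -
  define \<beta> where "\<beta> = (of_int u1 / of_int b1 :: real)"
  define p where "p = (of_int (b2 * r2) / of_int ((b2 - 1) * s2) :: real)"
  define \<gamma> where "\<gamma> = f p - p"
  \<comment> \<open>\<open>(b2 - 1) * s2\<close> clears \<open>p\<close>, and applying
    \<open>f\<close> brings in the further denominator \<open>b1 * s1\<close>.\<close>
  define s where "s = (b2 - 1) * s2 * (b1 * s1)"
  have \<beta>: "0 < \<beta>" "\<beta> < 1" using assms by (auto simp: \<beta>_def)
  have b2: "0 < real_of_int b2" "1 < real_of_int b2" using assms by auto
  have pos: "0 < real_of_int ((b2 - 1) * s2)" "0 < real_of_int (b1 * s1)" "0 < real_of_int b1" "0 < real_of_int s1"
      "0 < real_of_int s2" "0 < real_of_int ((b1 - u1) * s1)" "0 < real_of_int b2 - 1"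
    using assms by (auto intro!: mult_pos_pos simp flip: of_int_mult)
  have "0 < (b2 - 1) * s2" "0 < b1 * s1" using assms by (auto intro!: mult_pos_pos)
  then have "0 < s" unfolding s_def by (rule mult_pos_pos)
  then have s: "1 \<le> s" by simp
  have gp: "g (p + z) = p + z / of_int b2" for z
    using pos b2 unfolding g p_def by (simp add: divide_simps) (simp add: algebra_simps)
  have fp: "f (p + z) = p + \<gamma> + of_int u1 / of_int b1 * z" for z
    by (simp add: \<gamma>_def f add_divide_distrib algebra_simps)
  \<comment> \<open>\<open>p\<close> is fixed by \<open>g\<close>; if \<open>\<gamma>\<close>
    vanished, it would be fixed by \<open>f\<close> as well.\<close>
  have \<gamma>: "\<gamma> \<noteq> 0"
  proof
    assume "\<gamma> = 0"
    then have "of_int u1 / of_int b1 * p + of_int r1 / of_int s1 = p" by (simp add: \<gamma>_def f)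
    then have "of_int (b1 * r1) = p * of_int ((b1 - u1) * s1)"
      using pos by (simp add: divide_simps) (simp add: algebra_simps)
    then have "of_int (b1 * r1) / of_int ((b1 - u1) * s1) = p"
      using pos(6) by (metis less_irrefl nonzero_divide_eq_eq)
    with fixed_points show False by (simp only: p_def)
  qed
  have "of_int ((b2 - 1) * s2) * p = of_int (b2 * r2)"
    using pos by (simp add: p_def)
  then have "of_int s * p = of_int (b2 * r2 * (b1 * s1))"
    unfolding s_def of_int_mult[of "(b2 - 1) * s2"] by simp
  then have sp: "of_int s * p \<in> \<int>" by (metis Ints_of_int)
  have b1s1: "of_int (b1 * s1) * \<gamma> = of_int (u1 * s1 - b1 * s1) * p + of_int (b1 * r1)"
    using pos by (simp add: \<gamma>_def f field_simps)
  have "of_int s * \<gamma> = of_int ((b2 - 1) * s2) * (of_int (b1 * s1) * \<gamma>)"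
    by (simp add: s_def mult.assoc)
  also have "\<dots> = of_int (u1 * s1 - b1 * s1) * (of_int ((b2 - 1) * s2) * p) + of_int ((b2 - 1) * s2) * of_int (b1 * r1)"
    unfolding b1s1 by (simp add: algebra_simps)
  also have "\<dots> = of_int ((u1 * s1 - b1 * s1) * (b2 * r2) + (b2 - 1) * s2 * (b1 * r1))"
    unfolding \<open>of_int ((b2 - 1) * s2) * p = of_int (b2 * r2)\<close> by simp
  finally have s\<gamma>: "of_int s * \<gamma> \<in> \<int>" by (metis Ints_of_int)
  obtain L where L: "real_of_int s \<le> of_int b2 ^ L" "real_of_int b1 \<le> of_int b2 ^ L" "2 * \<bar>\<gamma>\<bar> \<le> of_int b2 ^ L"
    using ex_power_bound[OF b2(2)] by blast
  define n where "n = CARD('m) - 1"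
  have n: "1 \<le> n" "CARD('m) = Suc n" using m by (auto simp: n_def)
  obtain idx :: "'m \<Rightarrow> nat" where idx: "bij_betw idx UNIV {..n}"
    using ex_bij_betw_finite_nat[of "UNIV :: 'm set"] n(2) by (auto simp: atLeast0LessThan lessThan_Suc_atMost)
  have attr: "\<exists>!C. compact C \<and> C \<noteq> {} \<and> C = f ` C \<union> g ` C"
  proof (rule attractor_unique_existence)
    define c where "c = max \<beta> (1 / of_int b2)"
    show "0 \<le> c" "c < 1" using \<beta> b2 by (auto simp: c_def)
    show "\<bar>f x - f y\<bar> \<le> c * \<bar>x - y\<bar>" for x y
    proof -
      have "\<bar>f x - f y\<bar> = \<beta> * \<bar>x - y\<bar>"
        using \<beta> by (simp add: f \<beta>_def[symmetric] abs_mult flip: right_diff_distrib)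
      also have "\<dots> \<le> c * \<bar>x - y\<bar>" by (intro mult_right_mono) (auto simp: c_def)
      finally show ?thesis .
    qed
    show "\<bar>g x - g y\<bar> \<le> c * \<bar>x - y\<bar>" for x y
    proof -
      have "\<bar>g x - g y\<bar> = 1 / of_int b2 * \<bar>x - y\<bar>"
        using b2 by (simp add: g abs_divide flip: diff_divide_distrib)
      also have "\<dots> \<le> c * \<bar>x - y\<bar>" by (intro mult_right_mono) (auto simp: c_def)
      finally show ?thesis .
    qed
  qed
  have CC: "compact C \<and> C \<noteq> {} \<and> C = f ` C \<union> g ` C"
    unfolding C attractor_def by (rule theI'[OF attr])
  then have C': "f ` C \<subseteq> C" "g ` C \<subseteq> C" "closed C" "C \<noteq> {}"
    by (auto intro: compact_imp_closed)
  have main: "\<exists>\<xi>\<in>K. totally_irrational \<xi> \<and> liouville \<xi> \<and> omega_hat \<xi> = ereal \<omega>"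
    if \<omega>: "\<omega> \<in> {1 / real CARD('m) .. 1 / (real CARD('m) - 1)} \<union> {1}" for \<omega>
  proof -
    have \<omega>': "\<omega> \<in> {1 / (real n + 1) .. 1 / n} \<union> {1}" using \<omega> n by (simp add: add.commute)
    have "1 / (real n + 1) \<le> \<omega> \<or> \<omega> = 1" using \<omega>' by auto
    moreover have "0 < 1 / (real n + 1)" by simp
    ultimately have \<omega>_pos: "0 < \<omega>" by linarith
    obtain a where a: "\<And>k i. i < n \<Longrightarrow> a k i + k \<le> a k (Suc i)"
        "\<And>k. Suc k * (a k n + Suc k) \<le> a (Suc k) 0"
        "\<And>t::real. t < \<omega> \<Longrightarrow> \<forall>\<^sub>F k in sequentially. t * a k (n - 1) \<le> a k 0"
        "\<And>t::real. t < \<omega> \<Longrightarrow> \<forall>\<^sub>F k in sequentially. t * a k n \<le> real (a k n) - a k (n - 1)"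
        "\<And>t::real. \<omega> < t \<Longrightarrow> \<forall>\<^sub>F k in sequentially. a k 0 \<le> t * a k n"
        "\<And>t::real. \<omega> < t \<Longrightarrow> \<forall>\<^sub>F k in sequentially. \<forall>i<n. real (a k (Suc i)) - a k i \<le> t * a k n"
      using ex_exponents[OF n(1) \<omega>'] by blast
    interpret lacunary_vector b2 u1 b1 s p \<gamma> L n a idx
      by unfold_locales (use assms(1-6) s sp s\<gamma> \<gamma> L n idx a(1,2) in \<open>auto simp flip: of_int_power\<close>)
    have "point \<in> K"
      unfolding K using point_component_in[OF fp gp C'] by blast
    moreover have "omega_hat point = ereal \<omega>"
      using omega_hat_le[OF \<omega>_pos a(5,6)] omega_hat_ge[OF \<omega>_pos a(3,4)] by (rule antisym)
    ultimately show ?thesis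
      using totally_irrational_point liouville_point by blast
  qed
  moreover have "ereal ` ({1 / real CARD('m) .. 1 / (real CARD('m) - 1)} \<union> {1})
      \<subseteq> omega_hat ` {\<xi> \<in> K. totally_irrational \<xi>}"
  proof (rule image_subsetI)
    fix \<omega> assume "\<omega> \<in> {1 / real CARD('m) .. 1 / (real CARD('m) - 1)} \<union> {1}"
    from main[OF this] show "ereal \<omega> \<in> omega_hat ` {\<xi> \<in> K. totally_irrational \<xi>}"
      by (metis (mono_tags, lifting) image_eqI mem_Collect_eq)
  qed
  ultimately show ?thesis by blast
qed

end
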